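(* Let $\Omega\subset\mathbb{R}^N$ be a connected domain and let $V:\Omega\to\mathbb{R}$ be continuous with $$\int_{\Omega}\Big(|\nabla u(x)|^2+V(x)|u(x)|^2\Big)\,dx\ge 0\quad\text{for all }u\in C_0^\infty(\Omega).$$ Let $S$ be the Friedrichs extension in $L^2(\Omega)$ of $S_{\min}=(-\Delta+V)|_{C_0^\infty(\Omega)}$. If $S$ is subcritical, then for every $g\in C_0^\infty(\Omega)$ the solution $W_S(\cdot)g$ is uniformly bounded in $L^2(\Omega)$, that is, $\sup_{t\ge0}\|W_S(t)g\|_{L^2(\Omega)}<\infty$.
   Context: $N\ge 1$. The Friedrichs extension $S$ is a nonnegative selfadjoint operator in $L^2(\Omega)$. Definition (subcritical): $S$ is subcritical if for every nonnegative function $W\in C_0^\infty(\Omega)$ there exists a constant $\delta>0$ such that $$\delta\int_{\Omega}W(x)|u(x)|^2\,dx\le \int_{\Omega}\Big(|\nabla u(x)|^2+V(x)|u(x)|^2\Big)\,dx\quad\text{for all }u\in C_0^\infty(\Omega).$$ $W_S(\cdot)g$ denotes the solution $w$ of the wave equation $\partial_t^2w-\Delta w+Vw=0$ in $\Omega\times(0,\infty)$ with $w=0$ on $\partial\Omega\times(0,\infty)$ and $(w,\partial_tw)(\cdot,0)=(0,g)$, understood as the unique solution in $L^2(\Omega)$ of $w''(t)+Sw(t)=0$, $w(0)=0$, $w'(0)=g$; equivalently, $W_S(t)g=\phi_t(S)g$ by functional calculus with $\phi_t(\lambda)=\sin(t\sqrt\lambda)/\sqrt\lambda$ for $\lambda>0$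 and $\phi_t(0)=t$. *)

theory Defs
  imports "HOL-Analysis.Analysis"
begin

section \<open>Test functions and differential expressions\<close>

definition dir_deriv ::
  "'a::real_normed_vector \<Rightarrow> ('a \<Rightarrow> 'b::real_normed_vector) \<Rightarrow> 'a \<Rightarrow> 'b" where
  "dir_deriv v u = (\<lambda>x. frechet_derivative u (at x) v)"

text \<open>On a finite-dimensional space this is the usual class of k times continuously
  differentiable functions: differentiability together with continuity of all directional
  derivatives.\<close>

primrec Ck :: "nat \<Rightarrow> ('a::real_normed_vector \<Rightarrow> 'b::real_normed_vector) \<Rightarrow> bool" where
  "Ck 0 u \<longleftrightarrow> continuous_on UNIV u"
| "Ck (Suc k) u \<longleftrightarrow> (\<forall>x. u differentiable (at x)) \<and> (\<forall>v. Ck k (dir_deriv v u))"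

definition smooth :: "('a::real_normed_vector \<Rightarrow> 'b::real_normed_vector) \<Rightarrow> bool" where
  "smooth u \<longleftrightarrow> (\<forall>k. Ck k u)"

text \<open>Elements of \<open>C\<^sub>0\<^sup>\<infinity>(\<Omega>)\<close> are represented by their extension by zero to the whole space.\<close>

definition test_functions ::
  "'a::real_normed_vector set \<Rightarrow> ('a \<Rightarrow> 'b::real_normed_vector) set" where
  "test_functions \<Omega> =
     {u. smooth u \<and> compact (closure {x. u x \<noteq> 0}) \<and> closure {x. u x \<noteq> 0} \<subseteq> \<Omega>}"

definition grad_norm_sq :: "('a::euclidean_space \<Rightarrow> complex) \<Rightarrow> 'a \<Rightarrow> real" where
  "grad_norm_sq u x = (\<Sum>b\<in>Basis. (cmod (dir_deriv b u x))\<^sup>2)"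

definition laplacian :: "('a::euclidean_space \<Rightarrow> complex) \<Rightarrow> 'a \<Rightarrow> complex" where
  "laplacian u x = (\<Sum>b\<in>Basis. dir_deriv b (dir_deriv b u) x)"

definition energy_form ::
  "'a::euclidean_space set \<Rightarrow> ('a \<Rightarrow> real) \<Rightarrow> ('a \<Rightarrow> complex) \<Rightarrow> real" where
  "energy_form \<Omega> V u = (LINT x|lebesgue_on \<Omega>. grad_norm_sq u x + V x * (cmod (u x))\<^sup>2)"

definition subcritical :: "'a::euclidean_space set \<Rightarrow> ('a \<Rightarrow> real) \<Rightarrow> bool" where
  "subcritical \<Omega> V \<longleftrightarrow>
     (\<forall>W :: 'a \<Rightarrow> real. W \<in> test_functions \<Omega> \<and> (\<forall>x. 0 \<le> W x) \<longrightarrow>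
        (\<exists>\<delta>>0. \<forall>u\<in>test_functions \<Omega>.
           \<delta> * (LINT x|lebesgue_on \<Omega>. W x * (cmod (u x))\<^sup>2) \<le> energy_form \<Omega> V u))"


section \<open>The complex Hilbert space \<open>L\<^sup>2\<close>\<close>

text \<open>Vectors are represented by square-integrable functions; two functions represent the same
  vector iff they agree almost everywhere, that is, iff \<open>L2_norm\<close> of their difference is 0.\<close>

definition L2 :: "'a measure \<Rightarrow> ('a \<Rightarrow> complex) set" where
  "L2 M = {f. f \<in> borel_measurable M \<and> integrable M (\<lambda>x. (cmod (f x))\<^sup>2)}"

definition L2_norm :: "'a measure \<Rightarrow> ('a \<Rightarrow> complex) \<Rightarrow> real" where
  "L2_norm M f = sqrt (LINT x|M. (cmod (f x))\<^sup>2)"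

definition L2_inner :: "'a measure \<Rightarrow> ('a \<Rightarrow> complex) \<Rightarrow> ('a \<Rightarrow> complex) \<Rightarrow> complex" where
  "L2_inner M f g = (LINT x|M. f x * cnj (g x))"


section \<open>Operators in \<open>L\<^sup>2\<close> and the Friedrichs extension\<close>

text \<open>An operator is given by its graph, a set of pairs of representatives.\<close>

type_synonym 'a L2_operator = "(('a \<Rightarrow> complex) \<times> ('a \<Rightarrow> complex)) set"

definition L2_adjoint :: "'a measure \<Rightarrow> 'a L2_operator \<Rightarrow> 'a L2_operator" where
  "L2_adjoint M T =
     {(v, f). v \<in> L2 M \<and> f \<in> L2 M \<and> (\<forall>(u, h)\<in>T. L2_inner M h v = L2_inner M u f)}"

text \<open>For a densely defined nonnegative symmetric operator \<open>T\<close>, the domain of the closure of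
  the quadratic form \<open>u \<mapsto> \<langle>T u, u\<rangle>\<close>: all \<open>L\<^sup>2\<close>-limits of sequences in the domain of \<open>T\<close>
  that are Cauchy with respect to the form.\<close>

definition form_domain :: "'a measure \<Rightarrow> 'a L2_operator \<Rightarrow> ('a \<Rightarrow> complex) set" where
  "form_domain M T =
     {u \<in> L2 M. \<exists>\<phi> h :: nat \<Rightarrow> 'a \<Rightarrow> complex.
        (\<forall>n. (\<phi> n, h n) \<in> T) \<and>
        (\<lambda>n. L2_norm M (\<lambda>x. \<phi> n x - u x)) \<longlonglongrightarrow> 0 \<and>
        (\<forall>e>0. \<exists>K. \<forall>m\<ge>K. \<forall>n\<ge>K.
           cmod (L2_inner M (\<lambda>x. h m x - h n x) (\<lambda>x. \<phi> m x - \<phi> n x)) < e)}"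

text \<open>The Friedrichs extension of \<open>T\<close> is the restriction of the adjoint of \<open>T\<close> to those
  elements of its domain that belong to the form domain.\<close>

definition friedrichs_extension :: "'a measure \<Rightarrow> 'a L2_operator \<Rightarrow> 'a L2_operator" where
  "friedrichs_extension M T = {(u, f) \<in> L2_adjoint M T. u \<in> form_domain M T}"

definition S_min :: "'a::euclidean_space set \<Rightarrow> ('a \<Rightarrow> real) \<Rightarrow> 'a L2_operator" where
  "S_min \<Omega> V =
     {(u, \<lambda>x. - laplacian u x + complex_of_real (V x) * u x) | u. u \<in> test_functions \<Omega>}"

definition S_op :: "'a::euclidean_space set \<Rightarrow> ('a \<Rightarrow> real) \<Rightarrow> 'a L2_operator" where
  "S_op \<Omega> V = friedrichs_extension (lebesgue_on \<Omega>) (S_min \<Omega> V)"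


section \<open>The abstract wave equation\<close>

definition has_L2_deriv ::
  "'a measure \<Rightarrow> (real \<Rightarrow> 'a \<Rightarrow> complex) \<Rightarrow> (real \<Rightarrow> 'a \<Rightarrow> complex) \<Rightarrow> bool" where
  "has_L2_deriv M w w' \<longleftrightarrow>
     (\<forall>t\<ge>0. ((\<lambda>s. L2_norm M (\<lambda>x. (w s x - w t x) /\<^sub>R (s - t) - w' t x)) \<longlongrightarrow> 0)
              (at t within {0..}))"

definition L2_continuous :: "'a measure \<Rightarrow> (real \<Rightarrow> 'a \<Rightarrow> complex) \<Rightarrow> bool" where
  "L2_continuous M w \<longleftrightarrow>
     (\<forall>t\<ge>0. ((\<lambda>s. L2_norm M (\<lambda>x. w s x - w t x)) \<longlongrightarrow> 0) (at t within {0..}))"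

text \<open>\<open>w\<close> is a solution of \<open>w''(t) + S w(t) = 0\<close> for \<open>t \<ge> 0\<close> with \<open>w(0) = 0\<close>, \<open>w'(0) = g\<close>,
  twice continuously differentiable as a function from \<open>[0, \<infinity>)\<close> to \<open>L\<^sup>2\<close> and with values in the
  domain of \<open>S\<close>; \<open>w1\<close> and \<open>w2\<close> are the first and second time derivatives.  For selfadjoint
  \<open>S \<ge> 0\<close> and \<open>g\<close> in the domain of \<open>S\<close> there is exactly one such \<open>w\<close> (up to null sets),
  namely \<open>w(t) = sin (t \<surd>S) / \<surd>S g\<close>.\<close>

definition wave_solution ::
  "'a measure \<Rightarrow> 'a L2_operator \<Rightarrow> ('a \<Rightarrow> complex) \<Rightarrow> (real \<Rightarrow> 'a \<Rightarrow> complex) \<Rightarrow> bool" where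
  "wave_solution M S g w \<longleftrightarrow>
     (\<exists>w1 w2.
        (\<forall>t\<ge>0. w t \<in> L2 M \<and> w1 t \<in> L2 M \<and> w2 t \<in> L2 M) \<and>
        has_L2_deriv M w w1 \<and> has_L2_deriv M w1 w2 \<and> L2_continuous M w2 \<and>
        (\<forall>t\<ge>0. (w t, \<lambda>x. - w2 t x) \<in> S) \<and>
        (AE x in M. w 0 x = 0) \<and> (AE x in M. w1 0 x = g x))"

end

theory Submission
  imports Defs
begin

text \<open>Subcriticality with the weight \<open>W = |g|\<^sup>2\<close> shows that \<open>g\<close> is bounded with respect to the form:
  \<open>\<langle>g, u\<rangle>\<^sup>2 \<le> C q(u, u)\<close>.  Formally, \<open>X(t) = \<integral>\<^sub>0\<^sup>t w\<close> solves \<open>X'' + S X = g\<close> with vanishing initial data, so that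
  \<open>\<parallel>w(t)\<parallel>\<^sup>2 + q(X(t), X(t)) = 2 \<langle>g, X(t)\<rangle> \<le> 2 \<surd>(C q(X(t), X(t)))\<close>, whence \<open>\<parallel>w(t)\<parallel>\<^sup>2 \<le> C\<close>.
  The vector-valued integral is avoided: the form bound is applied to Riemann sums of \<open>w\<close>, and only
  the scalar functions \<open>\<langle>g, w(s)\<rangle>\<close> and \<open>\<langle>w(s), w(t)\<rangle>\<close> enter.  The latter satisfies the
  one-dimensional wave equation in \<open>(s, t)\<close> by symmetry of \<open>S\<close>, so d'Alembert's formula expresses it
  through the former.\<close>

section \<open>Real scalar products and derivatives in \<open>L\<^sup>2\<close>\<close>

text \<open>The obstacle is that X is a vector-valued integral, while the form bound for g is at
  first known only on test functions. A Riemann sum of \<open>w\<close> is a finite combination of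
  elements of the domain of S, and each of these is a limit of test functions along which the form
  converges; so finite sums suffice and all further limits are scalar. Because w(0) = 0, the
  diagonal case of d'Alembert's formula makes 2 ||w(t/2)||^2 the integral A(t) of <g, w(s)> over
  [0, t]. The form at X(T) becomes 2 A(T) - A(2 T) / 2, and since A(2 T) = 2 ||w(T)||^2 this is
  exactly the energy identity. What remains is A(T)^2 <= C (2 A(T) - A(2 T) / 2), which is settled
  by completing the square.\<close>

lemma nonneg_quadratic_discriminant:
  fixes a b c :: real
  assumes "\<And>t. 0 \<le> a + 2 * t * b + t\<^sup>2 * c"
  shows "b\<^sup>2 \<le> a * c"
proof (cases "c = 0")
  case True
  have "b = 0"
  proof (rule ccontr)
    assume "b \<noteq> 0"
    \<comment> \<open>At this t the affine function a + 2 t b takes the value -1.\<close>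
    with assms[of "- (a + 1) / (2 * b)"] True show False by (simp add: field_simps)
  qed
  with True show ?thesis by simp
next
  case False
  have "c > 0"
  proof (rule ccontr)
    assume "\<not> c > 0"
    with False have c: "c < 0" by simp
    \<comment> \<open>So large that the quadratic term outweighs the other two: with t >= 1 and t
      (-c) >= |a| + 2 |b| + 1 the value is at most -1.\<close>
    define t where "t = (\<bar>a\<bar> + 2 * \<bar>b\<bar> + 1) / (- c) + 1"
    have t1: "t \<ge> 1" using c by (simp add: t_def divide_nonneg_neg divide_nonpos_neg divide_le_0_iff)
    have tc: "t * (- c) \<ge> \<bar>a\<bar> + 2 * \<bar>b\<bar> + 1" using c by (simp add: t_def field_simps)
    have "t\<^sup>2 * (- c) \<ge> t * (\<bar>a\<bar> + 2 * \<bar>b\<bar> + 1)"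
      using mult_left_mono[OF tc, of t] t1 by (simp add: power2_eq_square mult.assoc)
    moreover have "t * (\<bar>a\<bar> + 1) \<ge> \<bar>a\<bar> + 1" using mult_right_mono[OF t1, of "\<bar>a\<bar> + 1"] by simp
    moreover have "t * \<bar>b\<bar> \<ge> t * b" using t1 by (intro mult_left_mono) auto
    moreover note assms[of t]
    ultimately show False by (simp add: algebra_simps)
  qed
  \<comment> \<open>The vertex of the parabola, where the value is a - b^2 / c.\<close>
  with assms[of "- b / c"] show ?thesis
    by (simp add: field_simps power2_eq_square)
qed

text \<open>The real part of \<open>L2_inner\<close>, with the complex numbers read as a Euclidean
  plane. It determines norms and form values, and it is real-valued, so the mean value theorem
  applies to scalar products along the solution.\<close>

definition L2_rinner :: "'a measure \<Rightarrow> ('a \<Rightarrow> complex) \<Rightarrow> ('a \<Rightarrow> complex) \<Rightarrow> real" where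
  "L2_rinner M f g = (LINT x|M. f x \<bullet> g x)"

lemma L2_borel [measurable_dest]: "f \<in> L2 M \<Longrightarrow> f \<in> borel_measurable M"
  by (simp add: L2_def)

lemma L2_integrable_inner:
  assumes "f \<in> L2 M" "g \<in> L2 M"
  shows "integrable M (\<lambda>x. f x \<bullet> g x)"
proof (rule Bochner_Integration.integrable_bound)
  show "integrable M (\<lambda>x. (cmod (f x))\<^sup>2 + (cmod (g x))\<^sup>2)"
    using assms by (auto simp: L2_def)
  show "(\<lambda>x. f x \<bullet> g x) \<in> borel_measurable M"
    using assms by (auto intro!: borel_measurable_inner L2_borel)
  have "\<bar>y \<bullet> z\<bar> \<le> (cmod y)\<^sup>2 + (cmod z)\<^sup>2" for y z :: complex
  proof -
    have "\<bar>y \<bullet> z\<bar> \<le> cmod y * cmod z" by (rule Cauchy_Schwarz_ineq2)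
    also have "\<dots> \<le> 2 * cmod y * cmod z" by simp
    also have "\<dots> \<le> (cmod y)\<^sup>2 + (cmod z)\<^sup>2" by (rule sum_squares_bound)
    finally show ?thesis .
  qed
  then show "AE x in M. norm (f x \<bullet> g x) \<le> norm ((cmod (f x))\<^sup>2 + (cmod (g x))\<^sup>2)"
    by simp
qed

lemma L2_scaleR: "f \<in> L2 M \<Longrightarrow> (\<lambda>x. c *\<^sub>R f x) \<in> L2 M"
  by (auto simp: L2_def power_mult_distrib)

lemma L2_add: "f \<in> L2 M \<Longrightarrow> g \<in> L2 M \<Longrightarrow> (\<lambda>x. f x + g x) \<in> L2 M"
  using L2_integrable_inner[of f M f] L2_integrable_inner[of g M g] L2_integrable_inner[of f M g]
  by (auto simp: L2_def power2_norm_eq_inner inner_add_left inner_add_right inner_commute)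

lemma L2_uminus: "f \<in> L2 M \<Longrightarrow> (\<lambda>x. - f x) \<in> L2 M"
  by (auto simp: L2_def)

lemma L2_diff: "f \<in> L2 M \<Longrightarrow> g \<in> L2 M \<Longrightarrow> (\<lambda>x. f x - g x) \<in> L2 M"
  using L2_add[of f M "\<lambda>x. - g x"] L2_uminus[of g M] by simp

lemma L2_zero: "(\<lambda>x. 0) \<in> L2 M"
  by (simp add: L2_def)

lemma L2_sum: "(\<And>i. i \<in> I \<Longrightarrow> f i \<in> L2 M) \<Longrightarrow> (\<lambda>x. \<Sum>i\<in>I. f i x) \<in> L2 M"
  by (induction I rule: infinite_finite_induct) (auto intro: L2_add L2_zero)

text \<open>Integration commutes with \<open>Re\<close> once the product is known to be integrable.
  Its imaginary part is again a pointwise real scalar product, of -i f with g, so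
  \<open>L2_integrable_inner\<close> covers both parts.\<close>

lemma Re_L2_inner:
  assumes "f \<in> L2 M" "g \<in> L2 M"
  shows "Re (L2_inner M f g) = L2_rinner M f g"
proof -
  have re: "Re (y * cnj z) = y \<bullet> z" and im: "Im (y * cnj z) = (- \<i> * y) \<bullet> z" for y z
    by (simp_all add: inner_complex_def)
  have "(\<lambda>x. - \<i> * f x) \<in> L2 M" using assms(1) by (auto simp: L2_def norm_mult)
  then have "integrable M (\<lambda>x. of_real (f x \<bullet> g x) + \<i> * of_real ((- \<i> * f x) \<bullet> g x))"
    using assms by (intro Bochner_Integration.integrable_add integrable_of_real
      integrable_mult_right L2_integrable_inner)
  also have "(\<lambda>x. of_real (f x \<bullet> g x) + \<i> * of_real ((- \<i> * f x) \<bullet> g x)) = (\<lambda>x. f x * cnj (g x))"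
    by (intro ext complex_eqI) (simp_all add: inner_complex_def)
  finally have "integrable M (\<lambda>x. f x * cnj (g x))" .
  then show ?thesis
    unfolding L2_inner_def L2_rinner_def by (subst integral_Re[symmetric]) (simp_all only: re)
qed

lemma L2_rinner_commute: "L2_rinner M f g = L2_rinner M g f"
  by (simp add: L2_rinner_def inner_commute)

lemma L2_rinner_add_left:
  "f \<in> L2 M \<Longrightarrow> g \<in> L2 M \<Longrightarrow> h \<in> L2 M \<Longrightarrow>
    L2_rinner M (\<lambda>x. f x + g x) h = L2_rinner M f h + L2_rinner M g h"
  by (simp add: L2_rinner_def inner_add_left L2_integrable_inner)

lemma L2_rinner_diff_left:
  "f \<in> L2 M \<Longrightarrow> g \<in> L2 M \<Longrightarrow> h \<in> L2 M \<Longrightarrow>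
    L2_rinner M (\<lambda>x. f x - g x) h = L2_rinner M f h - L2_rinner M g h"
  by (simp add: L2_rinner_def inner_diff_left L2_integrable_inner)

lemma L2_rinner_scaleR_left: "L2_rinner M (\<lambda>x. c *\<^sub>R f x) h = c * L2_rinner M f h"
  by (simp add: L2_rinner_def)

lemma L2_rinner_uminus_left: "L2_rinner M (\<lambda>x. - f x) h = - L2_rinner M f h"
  by (simp add: L2_rinner_def)

lemma L2_rinner_sum_left:
  "(\<And>i. i \<in> I \<Longrightarrow> f i \<in> L2 M) \<Longrightarrow> h \<in> L2 M \<Longrightarrow>
    L2_rinner M (\<lambda>x. \<Sum>i\<in>I. f i x) h = (\<Sum>i\<in>I. L2_rinner M (f i) h)"
  by (simp add: L2_rinner_def inner_sum_left L2_integrable_inner)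

lemma L2_rinner_add_right:
  "f \<in> L2 M \<Longrightarrow> g \<in> L2 M \<Longrightarrow> h \<in> L2 M \<Longrightarrow>
    L2_rinner M h (\<lambda>x. f x + g x) = L2_rinner M h f + L2_rinner M h g"
  by (simp add: L2_rinner_commute[of M h] L2_rinner_add_left)

lemma L2_rinner_diff_right:
  "f \<in> L2 M \<Longrightarrow> g \<in> L2 M \<Longrightarrow> h \<in> L2 M \<Longrightarrow>
    L2_rinner M h (\<lambda>x. f x - g x) = L2_rinner M h f - L2_rinner M h g"
  by (simp add: L2_rinner_commute[of M h] L2_rinner_diff_left)

lemma L2_rinner_scaleR_right: "L2_rinner M h (\<lambda>x. c *\<^sub>R f x) = c * L2_rinner M h f"
  by (simp add: L2_rinner_def)

lemma L2_rinner_sum_right: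
  "(\<And>i. i \<in> I \<Longrightarrow> f i \<in> L2 M) \<Longrightarrow> h \<in> L2 M \<Longrightarrow>
    L2_rinner M h (\<lambda>x. \<Sum>i\<in>I. f i x) = (\<Sum>i\<in>I. L2_rinner M h (f i))"
  by (simp add: L2_rinner_commute[of M h] L2_rinner_sum_left)

lemma L2_rinner_nonneg: "0 \<le> L2_rinner M f f"
  by (simp add: L2_rinner_def)

lemma L2_norm_rinner: "L2_norm M f = sqrt (L2_rinner M f f)"
  by (simp add: L2_norm_def L2_rinner_def power2_norm_eq_inner)

lemma L2_norm_power2: "(L2_norm M f)\<^sup>2 = L2_rinner M f f"
  by (simp add: L2_norm_rinner L2_rinner_nonneg)

lemma L2_rinner_cong_AE:
  assumes "AE x in M. f x = f' x" "f \<in> L2 M" "f' \<in> L2 M" "h \<in> L2 M"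
  shows "L2_rinner M f h = L2_rinner M f' h"
  unfolding L2_rinner_def using assms
  by (intro integral_cong_AE borel_measurable_inner L2_borel) auto

lemma L2_Cauchy_Schwarz:
  assumes "f \<in> L2 M" "g \<in> L2 M"
  shows "\<bar>L2_rinner M f g\<bar> \<le> L2_norm M f * L2_norm M g"
proof -
  have "(L2_rinner M f g)\<^sup>2 \<le> L2_rinner M f f * L2_rinner M g g"
  proof (rule nonneg_quadratic_discriminant)
    fix t :: real
    have "0 \<le> L2_rinner M (\<lambda>x. f x + t *\<^sub>R g x) (\<lambda>x. f x + t *\<^sub>R g x)"
      by (rule L2_rinner_nonneg)
    also have "\<dots> = L2_rinner M f f + 2 * t * L2_rinner M f g + t\<^sup>2 * L2_rinner M g g"
      using assms by (simp add: L2_rinner_add_left L2_rinner_add_right L2_scaleR L2_add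
        L2_rinner_scaleR_left L2_rinner_scaleR_right L2_rinner_commute[of M g f]
        algebra_simps power2_eq_square)
    finally show "0 \<le> L2_rinner M f f + 2 * t * L2_rinner M f g + t\<^sup>2 * L2_rinner M g g" .
  qed
  then have "sqrt ((L2_rinner M f g)\<^sup>2) \<le> sqrt (L2_rinner M f f * L2_rinner M g g)"
    by (rule real_sqrt_le_mono)
  then show ?thesis by (simp add: L2_norm_rinner real_sqrt_mult)
qed

text \<open>Expand both arguments around their limits and apply Cauchy-Schwarz to the three
  remainders. The filter is arbitrary because sequences, one-sided limits in time and limits in two
  time variables all occur.\<close>

lemma tendsto_L2_rinner:
  assumes f: "((\<lambda>s. L2_norm M (\<lambda>x. f s x - f0 x)) \<longlongrightarrow> 0) F"
    and g: "((\<lambda>s. L2_norm M (\<lambda>x. g s x - g0 x)) \<longlongrightarrow> 0) F"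
    and ev: "\<forall>\<^sub>F s in F. f s \<in> L2 M \<and> g s \<in> L2 M" and L: "f0 \<in> L2 M" "g0 \<in> L2 M"
  shows "((\<lambda>s. L2_rinner M (f s) (g s)) \<longlongrightarrow> L2_rinner M f0 g0) F"
proof -
  let ?a = "\<lambda>s. L2_norm M (\<lambda>x. f s x - f0 x)" and ?b = "\<lambda>s. L2_norm M (\<lambda>x. g s x - g0 x)"
  have "((\<lambda>s. ?a s * ?b s + ?a s * L2_norm M g0 + L2_norm M f0 * ?b s)
      \<longlongrightarrow> 0 * 0 + 0 * L2_norm M g0 + L2_norm M f0 * 0) F"
    by (intro tendsto_intros f g)
  then have lim: "((\<lambda>s. ?a s * ?b s + ?a s * L2_norm M g0 + L2_norm M f0 * ?b s) \<longlongrightarrow> 0) F" by simp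
  have "\<forall>\<^sub>F s in F. norm (L2_rinner M (f s) (g s) - L2_rinner M f0 g0)
      \<le> ?a s * ?b s + ?a s * L2_norm M g0 + L2_norm M f0 * ?b s"
    using ev
  proof eventually_elim
    case (elim s)
    let ?u = "\<lambda>x. f s x - f0 x" and ?v = "\<lambda>x. g s x - g0 x"
    have "L2_rinner M (f s) (g s) - L2_rinner M f0 g0
        = L2_rinner M ?u ?v + L2_rinner M ?u g0 + L2_rinner M f0 ?v"
      using elim L by (simp add: L2_rinner_diff_left L2_rinner_diff_right L2_diff)
    moreover have "\<bar>L2_rinner M ?u ?v\<bar> \<le> ?a s * ?b s"
        "\<bar>L2_rinner M ?u g0\<bar> \<le> ?a s * L2_norm M g0" "\<bar>L2_rinner M f0 ?v\<bar> \<le> L2_norm M f0 * ?b s"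
      using elim L by (auto intro!: L2_Cauchy_Schwarz L2_diff)
    ultimately show ?case by simp
  qed
  from tendsto_0_le[OF lim, of _ 1] this have "((\<lambda>s. L2_rinner M (f s) (g s) - L2_rinner M f0 g0) \<longlongrightarrow> 0) F"
    by (simp add: Lim_null_comparison lim)
  then show ?thesis by (simp add: LIM_zero_iff)
qed

text \<open>Strong differentiability at one point relative to a set of times, with the memberships
  in \<open>L2\<close> bundled in. The set matters because solutions are followed along segments of
  characteristics that end where a time reaches 0.\<close>

definition L2_deriv_at ::
  "'a measure \<Rightarrow> (real \<Rightarrow> 'a \<Rightarrow> complex) \<Rightarrow> ('a \<Rightarrow> complex) \<Rightarrow> real \<Rightarrow> real set \<Rightarrow> bool" where
  "L2_deriv_at M w w' t S \<longleftrightarrow> t \<in> S \<and> (\<forall>s\<in>S. w s \<in> L2 M) \<and> w' \<in> L2 M \<and>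
     ((\<lambda>s. L2_norm M (\<lambda>x. (w s x - w t x) /\<^sub>R (s - t) - w' x)) \<longlongrightarrow> 0) (at t within S)"

lemma L2_norm_scaleR: "L2_norm M (\<lambda>x. c *\<^sub>R f x) = \<bar>c\<bar> * L2_norm M f"
proof -
  have "L2_rinner M (\<lambda>x. c *\<^sub>R f x) (\<lambda>x. c *\<^sub>R f x) = c\<^sup>2 * L2_rinner M f f"
    by (simp add: L2_rinner_scaleR_left L2_rinner_scaleR_right power2_eq_square)
  then show ?thesis by (simp add: L2_norm_rinner real_sqrt_mult)
qed

lemma L2_deriv_at_imp_continuous:
  assumes "L2_deriv_at M w w' t S"
  shows "((\<lambda>s. L2_norm M (\<lambda>x. w s x - w t x)) \<longlongrightarrow> 0) (at t within S)"
proof -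
  let ?d = "\<lambda>s x. (w s x - w t x) /\<^sub>R (s - t)"
  have m: "t \<in> S" "\<And>s. s \<in> S \<Longrightarrow> w s \<in> L2 M" "w' \<in> L2 M"
    and d: "((\<lambda>s. L2_norm M (\<lambda>x. ?d s x - w' x)) \<longlongrightarrow> 0) (at t within S)"
    using assms by (auto simp: L2_deriv_at_def)
  have dm: "?d s \<in> L2 M" if "s \<in> S" for s
    by (intro L2_scaleR L2_diff m that)
  have ev: "\<forall>\<^sub>F s in at t within S. s \<in> S \<and> s \<noteq> t"
    by (auto simp: eventually_at_filter)
  have "((\<lambda>s. L2_rinner M (?d s) (?d s)) \<longlongrightarrow> L2_rinner M w' w') (at t within S)"
    by (rule tendsto_L2_rinner[OF d d]) (use ev m(3) dm in \<open>auto elim!: eventually_mono\<close>)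
  then have "((\<lambda>s. \<bar>s - t\<bar> * L2_norm M (?d s)) \<longlongrightarrow> \<bar>t - t\<bar> * sqrt (L2_rinner M w' w')) (at t within S)"
    unfolding L2_norm_rinner by (intro tendsto_intros)
  then have "((\<lambda>s. \<bar>s - t\<bar> * L2_norm M (?d s)) \<longlongrightarrow> 0) (at t within S)" by simp
  moreover have "\<forall>\<^sub>F s in at t within S. \<bar>s - t\<bar> * L2_norm M (?d s) = L2_norm M (\<lambda>x. w s x - w t x)"
    using ev by eventually_elim (subst L2_norm_scaleR[symmetric], simp)
  ultimately show ?thesis by (rule Lim_transform_eventually)
qed

text \<open>The usual product rule: the increment splits into <w(s) - w(t), v(s)> + <w(t), v(s) -
  v(t)>, and the first part also needs the strong continuity of v.\<close>

lemma L2_deriv_at_rinner: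
  assumes w: "L2_deriv_at M w w' t S" and v: "L2_deriv_at M v v' t S"
  shows "((\<lambda>s. L2_rinner M (w s) (v s)) has_real_derivative
           L2_rinner M w' (v t) + L2_rinner M (w t) v') (at t within S)"
proof -
  have m: "t \<in> S" "\<And>s. s \<in> S \<Longrightarrow> w s \<in> L2 M" "w' \<in> L2 M" "\<And>s. s \<in> S \<Longrightarrow> v s \<in> L2 M" "v' \<in> L2 M"
    and dw: "((\<lambda>s. L2_norm M (\<lambda>x. (w s x - w t x) /\<^sub>R (s - t) - w' x)) \<longlongrightarrow> 0) (at t within S)"
    and dv: "((\<lambda>s. L2_norm M (\<lambda>x. (v s x - v t x) /\<^sub>R (s - t) - v' x)) \<longlongrightarrow> 0) (at t within S)"
    using assms by (auto simp: L2_deriv_at_def)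
  have ev: "\<forall>\<^sub>F s in at t within S. s \<in> S \<and> s \<noteq> t"
    by (auto simp: eventually_at_filter)
  have dm: "(\<lambda>x. (w s x - w t x) /\<^sub>R (s - t)) \<in> L2 M" "(\<lambda>x. (v s x - v t x) /\<^sub>R (s - t)) \<in> L2 M"
    if "s \<in> S" for s
    by (intro L2_scaleR L2_diff m that)+
  have const: "((\<lambda>s. L2_norm M (\<lambda>x. w t x - w t x)) \<longlongrightarrow> 0) (at t within S)"
    by (simp add: L2_norm_def)
  have 1: "((\<lambda>s. L2_rinner M (\<lambda>x. (w s x - w t x) /\<^sub>R (s - t)) (v s)) \<longlongrightarrow> L2_rinner M w' (v t)) (at t within S)"
    by (rule tendsto_L2_rinner[OF dw L2_deriv_at_imp_continuous[OF v]])
      (use ev m dm in \<open>auto elim!: eventually_mono\<close>)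
  have 2: "((\<lambda>s. L2_rinner M (w t) (\<lambda>x. (v s x - v t x) /\<^sub>R (s - t))) \<longlongrightarrow> L2_rinner M (w t) v') (at t within S)"
    by (rule tendsto_L2_rinner[OF const dv])
      (use ev m dm in \<open>auto elim!: eventually_mono\<close>)
  show ?thesis
    unfolding has_field_derivative_iff
  proof (rule Lim_transform_eventually[OF tendsto_add[OF 1 2]])
    show "\<forall>\<^sub>F s in at t within S. L2_rinner M (\<lambda>x. (w s x - w t x) /\<^sub>R (s - t)) (v s) +
        L2_rinner M (w t) (\<lambda>x. (v s x - v t x) /\<^sub>R (s - t)) =
        (L2_rinner M (w s) (v s) - L2_rinner M (w t) (v t)) / (s - t)"
      using ev
    proof eventually_elim
      case (elim s)
      have "L2_rinner M (\<lambda>x. (w s x - w t x) /\<^sub>R (s - t)) (v s)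
          = (L2_rinner M (w s) (v s) - L2_rinner M (w t) (v s)) / (s - t)"
        "L2_rinner M (w t) (\<lambda>x. (v s x - v t x) /\<^sub>R (s - t))
          = (L2_rinner M (w t) (v s) - L2_rinner M (w t) (v t)) / (s - t)"
        using elim m unfolding L2_rinner_scaleR_left L2_rinner_scaleR_right
        by (simp_all add: L2_rinner_diff_left L2_rinner_diff_right divide_inverse_commute)
      then show ?case by (simp add: add_divide_distrib[symmetric])
    qed
  qed
qed

lemma L2_deriv_at_const:
  "t \<in> S \<Longrightarrow> f \<in> L2 M \<Longrightarrow> L2_deriv_at M (\<lambda>_. f) (\<lambda>_. 0) t S"
  by (simp add: L2_deriv_at_def L2_zero L2_norm_def)

text \<open>The chain rule for the substitutions that occur: e = 1 and e = -1 run along the two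
  families of characteristics, e = 1/2 along the rescaled diagonal.\<close>

lemma has_L2_deriv_affine:
  assumes d: "has_L2_deriv M w w1" and m: "\<And>t. t \<ge> 0 \<Longrightarrow> w t \<in> L2 M \<and> w1 t \<in> L2 M"
    and e: "e \<noteq> 0" and S: "\<And>s. s \<in> S \<Longrightarrow> 0 \<le> c + e * s" and t: "t \<in> S"
  shows "L2_deriv_at M (\<lambda>s. w (c + e * s)) (\<lambda>x. e *\<^sub>R w1 (c + e * t) x) t S"
  unfolding L2_deriv_at_def
proof (intro conjI ballI t)
  show "w (c + e * s) \<in> L2 M" if "s \<in> S" for s using m S[OF that] by blast
  show "(\<lambda>x. e *\<^sub>R w1 (c + e * t) x) \<in> L2 M" using m S[OF t] by (intro L2_scaleR) blast
  let ?T = "c + e * t"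
  have flim: "filterlim (\<lambda>s. c + e * s) (at ?T within {0..}) (at t within S)"
    unfolding filterlim_at
  proof
    show "((\<lambda>s. c + e * s) \<longlongrightarrow> ?T) (at t within S)" by (intro tendsto_intros)
    show "\<forall>\<^sub>F s in at t within S. c + e * s \<in> {0..} \<and> c + e * s \<noteq> ?T"
      using S e by (auto simp: eventually_at_filter)
  qed
  have "((\<lambda>s. L2_norm M (\<lambda>x. (w s x - w ?T x) /\<^sub>R (s - ?T) - w1 ?T x)) \<longlongrightarrow> 0) (at ?T within {0..})"
    using d S[OF t] unfolding has_L2_deriv_def by simp
  from filterlim_compose[OF this flim]
  have lim: "((\<lambda>s. \<bar>e\<bar> * L2_norm M (\<lambda>x. (w (c + e * s) x - w ?T x) /\<^sub>R ((c + e * s) - ?T) - w1 ?T x)) \<longlongrightarrow> 0) (at t within S)"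
    by (rule tendsto_mult_right_zero)
  have eq: "\<bar>e\<bar> * L2_norm M (\<lambda>x. (w (c + e * s) x - w ?T x) /\<^sub>R ((c + e * s) - ?T) - w1 ?T x) =
      L2_norm M (\<lambda>x. (w (c + e * s) x - w ?T x) /\<^sub>R (s - t) - e *\<^sub>R w1 ?T x)" for s
  proof -
    have "e *\<^sub>R ((w (c + e * s) x - w ?T x) /\<^sub>R ((c + e * s) - ?T) - w1 ?T x) =
      (w (c + e * s) x - w ?T x) /\<^sub>R (s - t) - e *\<^sub>R w1 ?T x" for x
    proof -
      have *: "(c + e * s) - ?T = e * (s - t)" by (simp add: algebra_simps)
      have "e * inverse (e * (s - t)) = inverse (s - t)"
        using e by (simp add: inverse_mult_distrib mult.assoc[symmetric] del: right_diff_distrib)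
      then show ?thesis unfolding * by (simp only: scaleR_diff_right[of e] scaleR_scaleR)
    qed
    then have "(\<lambda>x. e *\<^sub>R ((w (c + e * s) x - w ?T x) /\<^sub>R ((c + e * s) - ?T) - w1 ?T x)) =
      (\<lambda>x. (w (c + e * s) x - w ?T x) /\<^sub>R (s - t) - e *\<^sub>R w1 ?T x)" by (rule ext)
    from arg_cong[OF this, of "L2_norm M"] show ?thesis by (simp only: L2_norm_scaleR)
  qed
  show "((\<lambda>s. L2_norm M (\<lambda>x. (w (c + e * s) x - w ?T x) /\<^sub>R (s - t) - e *\<^sub>R w1 ?T x)) \<longlongrightarrow> 0) (at t within S)"
    using lim unfolding eq .
qed

section \<open>Test functions and integration by parts\<close>

lemma Ck_imp_continuous: "Ck k u \<Longrightarrow> continuous_on UNIV u"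
  by (cases k) (auto simp: continuous_on_eq_continuous_at differentiable_imp_continuous_within)

lemma Ck_Suc_imp_Ck: "Ck (Suc k) u \<Longrightarrow> Ck k u"
proof (induction k arbitrary: u)
  case 0
  then show ?case using Ck_imp_continuous[of "Suc 0" u] by simp
next
  case (Suc k)
  then show ?case by (metis Ck.simps(2))
qed

lemma dir_deriv_has_derivative:
  "(u has_derivative u') (at x) \<Longrightarrow> dir_deriv v u x = u' v"
  by (simp add: dir_deriv_def frechet_derivative_at[symmetric])

lemma differentiable_has_derivative:
  "u differentiable (at x) \<Longrightarrow> (u has_derivative (\<lambda>v. dir_deriv v u x)) (at x)"
  by (simp add: dir_deriv_def frechet_derivative_works)

lemma dir_deriv_add:
  assumes "\<And>x. u differentiable (at x)" "\<And>x. w differentiable (at x)"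
  shows "dir_deriv v (\<lambda>x. u x + w x) = (\<lambda>x. dir_deriv v u x + dir_deriv v w x)"
  using assms by (intro ext dir_deriv_has_derivative[where u' = "\<lambda>v. _ v + _ v"]
    has_derivative_add differentiable_has_derivative)

lemma dir_deriv_scaleR:
  assumes "\<And>x. u differentiable (at x)"
  shows "dir_deriv v (\<lambda>x. c *\<^sub>R u x) = (\<lambda>x. c *\<^sub>R dir_deriv v u x)"
  using assms by (intro ext dir_deriv_has_derivative has_derivative_scaleR_right
    differentiable_has_derivative)

lemma dir_deriv_inner:
  fixes u w :: "'a::real_normed_vector \<Rightarrow> 'b::real_inner"
  assumes "\<And>x. u differentiable (at x)" "\<And>x. w differentiable (at x)"
  shows "dir_deriv v (\<lambda>x. u x \<bullet> w x) = (\<lambda>x. u x \<bullet> dir_deriv v w x + dir_deriv v u x \<bullet> w x)"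
proof
  fix x
  show "dir_deriv v (\<lambda>x. u x \<bullet> w x) x = u x \<bullet> dir_deriv v w x + dir_deriv v u x \<bullet> w x"
    by (rule dir_deriv_has_derivative)
      (intro has_derivative_inner differentiable_has_derivative assms)
qed

lemma Ck_const: "Ck k (\<lambda>_. c)"
proof (induction k arbitrary: c)
  case (Suc k)
  have "dir_deriv v (\<lambda>_. c) = (\<lambda>_. 0)" for v :: 'a
    by (intro ext dir_deriv_has_derivative has_derivative_const)
  with Suc show ?case by simp
qed simp

lemma Ck_add: "Ck k u \<Longrightarrow> Ck k w \<Longrightarrow> Ck k (\<lambda>x. u x + w x)"
  by (induction k arbitrary: u w) (auto simp: dir_deriv_add intro!: continuous_on_add)

lemma Ck_scaleR: "Ck k u \<Longrightarrow> Ck k (\<lambda>x. c *\<^sub>R u x)"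
  by (induction k arbitrary: u) (auto simp: dir_deriv_scaleR intro!: continuous_on_scaleR)

lemma Ck_inner:
  fixes u w :: "'a::real_normed_vector \<Rightarrow> 'b::real_inner"
  shows "Ck k u \<Longrightarrow> Ck k w \<Longrightarrow> Ck k (\<lambda>x. u x \<bullet> w x)"
proof (induction k arbitrary: u w)
  case 0
  then show ?case by (auto intro!: continuous_on_inner)
next
  case (Suc k)
  have du: "\<And>x. u differentiable (at x)" "\<And>x. w differentiable (at x)"
    using Suc.prems by auto
  have "(\<lambda>x. u x \<bullet> w x) differentiable (at x)" for x
    using has_derivative_inner[OF differentiable_has_derivative[OF du(1)] differentiable_has_derivative[OF du(2)]]
    by (rule differentiableI)
  moreover have "Ck k (dir_deriv v (\<lambda>x. u x \<bullet> w x))" for v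
    unfolding dir_deriv_inner[OF du] using Suc.prems
    by (intro Ck_add Suc.IH Ck_Suc_imp_Ck[OF Suc.prems(1)] Ck_Suc_imp_Ck[OF Suc.prems(2)]) auto
  ultimately show ?case by simp
qed

lemma smooth_imp_continuous: "smooth u \<Longrightarrow> continuous_on UNIV u"
  unfolding smooth_def using Ck_imp_continuous by blast

lemma smooth_differentiable: "smooth u \<Longrightarrow> u differentiable (at x)"
  unfolding smooth_def by (metis Ck.simps(2))

lemma smooth_dir_deriv: "smooth u \<Longrightarrow> smooth (dir_deriv v u)"
  unfolding smooth_def by (metis Ck.simps(2))

lemma smooth_add: "smooth u \<Longrightarrow> smooth w \<Longrightarrow> smooth (\<lambda>x. u x + w x)"
  by (simp add: smooth_def Ck_add)

lemma smooth_scaleR: "smooth u \<Longrightarrow> smooth (\<lambda>x. c *\<^sub>R u x)"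
  by (simp add: smooth_def Ck_scaleR)

lemma smooth_inner:
  fixes u w :: "'a::real_normed_vector \<Rightarrow> 'b::real_inner"
  shows "smooth u \<Longrightarrow> smooth w \<Longrightarrow> smooth (\<lambda>x. u x \<bullet> w x)"
  by (simp add: smooth_def Ck_inner)

lemma dir_deriv_zero_outside_support:
  assumes "x \<notin> closure {x. u x \<noteq> 0}"
  shows "dir_deriv v u x = 0"
proof (rule dir_deriv_has_derivative)
  show "(u has_derivative (\<lambda>_. 0)) (at x)"
    using has_derivative_const[of 0 "at x"]
  proof (rule has_derivative_transform_within_open[where s = "- closure {x. u x \<noteq> 0}"])
    show "0 = u y" if "y \<in> - closure {x. u x \<noteq> 0}" for y
      using that closure_subset[of "{x. u x \<noteq> 0}"] by auto
  qed (use assms in auto)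
qed

lemma compact_supportI:
  fixes u :: "'a::metric_space \<Rightarrow> 'b::zero"
  assumes "compact K" "K \<subseteq> \<Omega>" "\<And>x. x \<notin> K \<Longrightarrow> u x = 0"
  shows "compact (closure {x. u x \<noteq> 0})" "closure {x. u x \<noteq> 0} \<subseteq> \<Omega>"
proof -
  have "closure {x. u x \<noteq> 0} \<subseteq> K"
    using assms by (intro closure_minimal compact_imp_closed) auto
  then show "compact (closure {x. u x \<noteq> 0})" "closure {x. u x \<noteq> 0} \<subseteq> \<Omega>"
    using assms compact_Int_closed[OF assms(1) closed_closure, of "{x. u x \<noteq> 0}"]
    by (auto simp: Int_absorb1)
qed

lemma test_functionsD:
  assumes "u \<in> test_functions \<Omega>"
  obtains K where "compact K" "K \<subseteq> \<Omega>" "\<And>x. x \<notin> K \<Longrightarrow> u x = 0"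
    "\<And>v x. x \<notin> K \<Longrightarrow> dir_deriv v u x = 0" "\<And>v v' x. x \<notin> K \<Longrightarrow> dir_deriv v (dir_deriv v' u) x = 0"
proof
  let ?K = "closure {x. u x \<noteq> 0}"
  show "compact ?K" "?K \<subseteq> \<Omega>" using assms by (auto simp: test_functions_def)
  show 0: "u x = 0" if "x \<notin> ?K" for x
    using that closure_subset[of "{x. u x \<noteq> 0}"] by blast
  show 1: "dir_deriv v u x = 0" if "x \<notin> ?K" for v x
    using that by (rule dir_deriv_zero_outside_support)
  show "dir_deriv v (dir_deriv v' u) x = 0" if "x \<notin> ?K" for v v' x
  proof (rule dir_deriv_zero_outside_support)
    have "closure {x. dir_deriv v' u x \<noteq> 0} \<subseteq> ?K"
      using 1 by (intro closure_minimal) auto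
    with that show "x \<notin> closure {x. dir_deriv v' u x \<noteq> 0}" by blast
  qed
qed

lemma test_functions_smooth: "u \<in> test_functions \<Omega> \<Longrightarrow> smooth u"
  by (simp add: test_functions_def)

lemma test_functions_zero: "(\<lambda>_. 0) \<in> test_functions \<Omega>"
  by (simp add: test_functions_def smooth_def Ck_const)

lemma test_functions_add:
  fixes u w :: "'a::real_normed_vector \<Rightarrow> 'b::real_normed_vector"
  assumes "u \<in> test_functions \<Omega>" "w \<in> test_functions \<Omega>"
  shows "(\<lambda>x. u x + w x) \<in> test_functions \<Omega>"
proof -
  obtain K where K: "compact K" "K \<subseteq> \<Omega>" "\<And>x. x \<notin> K \<Longrightarrow> u x = 0"
    using test_functionsD[OF assms(1)] by metis
  obtain L where L: "compact L" "L \<subseteq> \<Omega>" "\<And>x. x \<notin> L \<Longrightarrow> w x = 0"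
    using test_functionsD[OF assms(2)] by metis
  have "compact (K \<union> L)" "K \<union> L \<subseteq> \<Omega>" "\<And>x. x \<notin> K \<union> L \<Longrightarrow> u x + w x = 0"
    using K L by auto
  from compact_supportI[OF this] show ?thesis
    using assms by (auto simp: test_functions_def smooth_add)
qed

lemma test_functions_scaleR:
  fixes u :: "'a::real_normed_vector \<Rightarrow> 'b::real_normed_vector"
  assumes "u \<in> test_functions \<Omega>"
  shows "(\<lambda>x. c *\<^sub>R u x) \<in> test_functions \<Omega>"
proof -
  obtain K where K: "compact K" "K \<subseteq> \<Omega>" "\<And>x. x \<notin> K \<Longrightarrow> u x = 0"
    using test_functionsD[OF assms] by metis
  then have "\<And>x. x \<notin> K \<Longrightarrow> c *\<^sub>R u x = 0" by simp
  from compact_supportI[OF K(1,2) this] show ?thesis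
    using assms by (auto simp: test_functions_def smooth_scaleR)
qed

lemma test_functions_diff:
  fixes u w :: "'a::real_normed_vector \<Rightarrow> 'b::real_normed_vector"
  assumes "u \<in> test_functions \<Omega>" "w \<in> test_functions \<Omega>"
  shows "(\<lambda>x. u x - w x) \<in> test_functions \<Omega>"
  using test_functions_add[OF assms(1) test_functions_scaleR[OF assms(2), of "-1"]] by simp

lemma test_functions_sum:
  fixes u :: "'i \<Rightarrow> 'a::real_normed_vector \<Rightarrow> 'b::real_normed_vector"
  shows "(\<And>i. i \<in> I \<Longrightarrow> u i \<in> test_functions \<Omega>) \<Longrightarrow> (\<lambda>x. \<Sum>i\<in>I. u i x) \<in> test_functions \<Omega>"
  by (induction I rule: infinite_finite_induct) (auto intro: test_functions_add test_functions_zero)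

text \<open>Makes |g|^2 an admissible weight: as a scalar product it is smooth even at the zeros of
  g, and it has the same support.\<close>

lemma test_functions_norm_sq:
  fixes u :: "'a::real_normed_vector \<Rightarrow> 'b::real_inner"
  assumes "u \<in> test_functions \<Omega>"
  shows "(\<lambda>x. (norm (u x))\<^sup>2) \<in> test_functions \<Omega>"
proof -
  have "smooth (\<lambda>x. (norm (u x))\<^sup>2)"
    using smooth_inner[of u u] assms by (simp add: test_functions_smooth power2_norm_eq_inner)
  then show ?thesis using assms by (simp add: test_functions_def)
qed

section \<open>Integration by parts for compactly supported functions\<close>

lemma integrable_compact_support:
  fixes f :: "'a::euclidean_space \<Rightarrow> 'b::euclidean_space"
  assumes "compact K" "continuous_on UNIV f" "\<And>x. x \<notin> K \<Longrightarrow> f x = 0"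
  shows "integrable lborel f"
proof -
  have "integrable lborel (\<lambda>x. indicator K x *\<^sub>R f x)"
    using assms by (intro borel_integrable_compact) (auto intro: continuous_on_subset)
  also have "(\<lambda>x. indicator K x *\<^sub>R f x) = f"
    using assms(3) by (auto simp: indicator_def)
  finally show ?thesis .
qed

lemma integral_lborel_translation:
  fixes f :: "'a::euclidean_space \<Rightarrow> real"
  assumes "f \<in> borel_measurable borel"
  shows "(LINT x|lborel. f (x + c)) = (LINT x|lborel. f x)"
proof -
  have "(LINT x|lborel. f x) = (LINT x|distr lborel borel ((+) c). f x)"
    by (simp add: lborel_distr_plus)
  also have "\<dots> = (LINT x|lborel. f (c + x))"
    using assms by (intro integral_distr) auto
  finally show ?thesis by (simp add: add.commute)
qed

text \<open>The difference quotients have vanishing integral by translation invariance; pass to the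
  limit by dominated convergence.\<close>

lemma integral_dir_deriv_eq_0:
  fixes f :: "'a::euclidean_space \<Rightarrow> real"
  assumes K: "compact K" "\<And>x. x \<notin> K \<Longrightarrow> f x = 0" and f: "Ck 1 f"
  shows "(LINT x|lborel. dir_deriv v f x) = 0"
proof -
  have diff: "\<And>x. f differentiable (at x)" and cont': "continuous_on UNIV (dir_deriv v f)"
    using f by auto
  have cont: "continuous_on UNIV f" using f Ck_imp_continuous by blast
  \<comment> \<open>Linearity of the derivative turns direction h v into h times direction v, so
    restriction to a line gives an ordinary derivative, to which the mean value theorem
    applies.\<close>
  have line: "((\<lambda>t. f (x + t *\<^sub>R v)) has_real_derivative dir_deriv v f (x + t *\<^sub>R v)) (at t within S)" for x t S
  proof -
    have "((\<lambda>t. f (x + t *\<^sub>R v)) has_derivative (\<lambda>h. dir_deriv (0 + h *\<^sub>R v) f (x + t *\<^sub>R v))) (at t within S)"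
      by (rule has_derivative_compose[OF _ differentiable_has_derivative[OF diff]])
        (intro derivative_intros)
    moreover have "dir_deriv (0 + h *\<^sub>R v) f (x + t *\<^sub>R v) = dir_deriv v f (x + t *\<^sub>R v) * h" for h
      using linear_scale[OF has_derivative_linear[OF differentiable_has_derivative[OF diff]], of h v "x + t *\<^sub>R v"]
      by simp
    ultimately show ?thesis by (simp add: has_field_derivative_def)
  qed
  have out: "dir_deriv v f x = 0" if "x \<notin> K" for x
  proof (rule dir_deriv_zero_outside_support)
    have "closure {x. f x \<noteq> 0} \<subseteq> K" using K by (intro closure_minimal compact_imp_closed) auto
    with that show "x \<notin> closure {x. f x \<noteq> 0}" by blast
  qed
  have "bounded (dir_deriv v f ` K)"
    using K cont' by (intro compact_imp_bounded compact_continuous_image) (auto intro: continuous_on_subset)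
  then obtain B where B: "\<And>x. x \<in> K \<Longrightarrow> norm (dir_deriv v f x) \<le> B" "B > 0"
    unfolding bounded_pos by blast
  then have B': "\<bar>dir_deriv v f x\<bar> \<le> B" for x using out[of x] by (cases "x \<in> K") auto
  define h where "h n = inverse (real (Suc n))" for n
  have h: "h n > 0" "h n \<le> 1" for n by (auto simp: h_def inverse_le_1_iff)
  have h0: "h \<longlonglongrightarrow> 0" unfolding h_def using LIMSEQ_inverse_real_of_nat .
  define q where "q n x = (f (x + h n *\<^sub>R v) - f x) / h n" for n x
  \<comment> \<open>K swept backwards along v for unit time: since 0 < h n <= 1, this one compact
    set contains the supports of all difference quotients.\<close>
  define L where "L = (\<lambda>(x, t). x - t *\<^sub>R v) ` (K \<times> {0..1::real})"
  have L: "compact L" unfolding L_def using K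
    by (intro compact_continuous_image compact_Times) (auto simp: case_prod_unfold intro!: continuous_intros)
  have inL: "x \<in> L" if "x + t *\<^sub>R v \<in> K" "0 \<le> t" "t \<le> 1" for x t
    unfolding L_def using that by (intro image_eqI[of _ _ "(x + t *\<^sub>R v, t)"]) auto
  have int_f: "integrable lborel f" by (rule integrable_compact_support[OF K(1) cont K(2)])
  have fm: "f \<in> borel_measurable borel" using cont by (rule borel_measurable_continuous_onI)
  have int_shift: "integrable lborel (\<lambda>x. f (x + h n *\<^sub>R v))" for n
  proof (rule integrable_compact_support[OF L])
    show "continuous_on UNIV (\<lambda>x. f (x + h n *\<^sub>R v))"
      by (intro continuous_on_compose2[OF cont] continuous_intros) auto
    show "f (x + h n *\<^sub>R v) = 0" if "x \<notin> L" for x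
      using K(2) inL[of x "h n"] h[of n] that by fastforce
  qed
  have int_q: "(LINT x|lborel. q n x) = 0" for n
    unfolding q_def using int_f int_shift[of n] integral_lborel_translation[OF fm] by simp
  have bound: "\<bar>q n x\<bar> \<le> indicator L x * B" for n x
  proof (cases "x \<in> L")
    case True
    obtain z where "f (x + h n *\<^sub>R v) - f (x + 0 *\<^sub>R v) = (h n - 0) * dir_deriv v f (x + z *\<^sub>R v)"
      using MVT2[of 0 "h n" "\<lambda>t. f (x + t *\<^sub>R v)" "\<lambda>t. dir_deriv v f (x + t *\<^sub>R v)"] line h[of n] by auto
    then have "q n x = dir_deriv v f (x + z *\<^sub>R v)" using h[of n] by (simp add: q_def)
    with B' True show ?thesis by simp
  next
    case False
    then have "x \<notin> K" "x + h n *\<^sub>R v \<notin> K" using inL[of x 0] inL[of x "h n"] h[of n] by auto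
    then show ?thesis using K(2) B(2) by (simp add: q_def)
  qed
  have "(\<lambda>n. LINT x|lborel. q n x) \<longlonglongrightarrow> (LINT x|lborel. dir_deriv v f x)"
  proof (rule integral_dominated_convergence)
    show "dir_deriv v f \<in> borel_measurable lborel" "q n \<in> borel_measurable lborel" for n
      using cont' fm unfolding q_def by (auto intro: borel_measurable_continuous_onI)
    show "integrable lborel (\<lambda>x. indicator L x * B)"
      using borel_integrable_compact[OF L, of "\<lambda>_. B"] by simp
    show "AE x in lborel. (\<lambda>n. q n x) \<longlonglongrightarrow> dir_deriv v f x"
    proof (intro AE_I2)
      fix x
      have "((\<lambda>t. (f (x + t *\<^sub>R v) - f (x + 0 *\<^sub>R v)) / (t - 0)) \<longlongrightarrow> dir_deriv v f (x + 0 *\<^sub>R v)) (at 0)"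
        using line[of x 0 UNIV] unfolding has_field_derivative_iff .
      moreover have "filterlim h (at 0) sequentially"
        using h0 h by (auto simp: filterlim_at eventually_sequentially) (metis less_irrefl)
      ultimately show "(\<lambda>n. q n x) \<longlonglongrightarrow> dir_deriv v f x"
        using filterlim_compose unfolding q_def by fastforce
    qed
    show "AE x in lborel. norm (q n x) \<le> indicator L x * B" for n
      using bound by simp
  qed
  then have "(\<lambda>n. 0) \<longlonglongrightarrow> (LINT x|lborel. dir_deriv v f x)" unfolding int_q .
  then show ?thesis by (simp add: LIMSEQ_const_iff)
qed

text \<open>After extension by zero everything takes place on the whole space and no boundary term
  arises. The vanishing integral is that of the b-derivative of
  \<open>dir_deriv b \<phi> x \<bullet> \<psi> x\<close>, summed over the basis.\<close>

lemma integral_by_parts: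
  fixes \<phi> \<psi> :: "'a::euclidean_space \<Rightarrow> complex"
  assumes \<phi>: "\<phi> \<in> test_functions UNIV" and \<psi>: "\<psi> \<in> test_functions UNIV"
  shows "(LINT x|lborel. - laplacian \<phi> x \<bullet> \<psi> x)
       = (LINT x|lborel. (\<Sum>b\<in>Basis. dir_deriv b \<phi> x \<bullet> dir_deriv b \<psi> x))"
proof -
  obtain K where K: "compact K" "\<And>x. x \<notin> K \<Longrightarrow> \<psi> x = 0" "\<And>x v. x \<notin> K \<Longrightarrow> dir_deriv v \<psi> x = 0"
    using test_functionsD[OF \<psi>] by metis
  have s: "smooth \<phi>" "smooth \<psi>" using assms by (auto simp: test_functions_smooth)
  let ?f = "\<lambda>b x. dir_deriv b (dir_deriv b \<phi>) x \<bullet> \<psi> x"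
  let ?g = "\<lambda>b x. dir_deriv b \<phi> x \<bullet> dir_deriv b \<psi> x"
  have f: "integrable lborel (?f b)" and g: "integrable lborel (?g b)" for b
  proof -
    have "continuous_on UNIV (?f b)" "continuous_on UNIV (?g b)"
      by (intro smooth_imp_continuous smooth_inner smooth_dir_deriv s)+
    then show "integrable lborel (?f b)" "integrable lborel (?g b)"
      using K by (auto intro: integrable_compact_support[OF K(1)])
  qed
  have fg: "(LINT x|lborel. ?f b x) = - (LINT x|lborel. ?g b x)" for b
  proof -
    have "(LINT x|lborel. dir_deriv b (\<lambda>x. dir_deriv b \<phi> x \<bullet> \<psi> x) x) = 0"
    proof (rule integral_dir_deriv_eq_0[OF K(1)])
      have "smooth (\<lambda>x. dir_deriv b \<phi> x \<bullet> \<psi> x)" by (intro smooth_inner smooth_dir_deriv s)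
      then show "Ck 1 (\<lambda>x. dir_deriv b \<phi> x \<bullet> \<psi> x)" by (simp add: smooth_def)
    qed (simp add: K)
    then have "(LINT x|lborel. ?g b x + ?f b x) = 0"
      using s by (subst (asm) dir_deriv_inner) (auto intro: smooth_differentiable smooth_dir_deriv)
    then show ?thesis using f g by simp
  qed
  have "(LINT x|lborel. - laplacian \<phi> x \<bullet> \<psi> x) = (\<Sum>b\<in>Basis. - (LINT x|lborel. ?f b x))"
    using f by (simp add: laplacian_def inner_sum_left sum_negf)
  also have "\<dots> = (LINT x|lborel. (\<Sum>b\<in>Basis. ?g b x))"
    using g by (simp add: fg)
  finally show ?thesis .
qed

section \<open>The energy form and the Friedrichs extension\<close>

text \<open>Continuity is asked on \<Omega> only, because the potential may be singular at the
  boundary. As f vanishes off K, multiplying it by the indicator of K or of \<Omega> changes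
  nothing, which links the two integrals.\<close>

lemma lebesgue_on_compact_support:
  fixes f :: "'a::euclidean_space \<Rightarrow> 'b::euclidean_space"
  assumes K: "compact K" "K \<subseteq> \<Omega>" "\<And>x. x \<notin> K \<Longrightarrow> f x = 0"
    and "open \<Omega>" "continuous_on \<Omega> f"
  shows "f \<in> borel_measurable (lebesgue_on \<Omega>)" "integrable (lebesgue_on \<Omega>) f"
    "(LINT x|lebesgue_on \<Omega>. f x) = (LINT x|lborel. f x)"
proof -
  have \<Omega>: "\<Omega> \<in> sets lebesgue" using \<open>open \<Omega>\<close> by auto
  show "f \<in> borel_measurable (lebesgue_on \<Omega>)"
    using \<open>continuous_on \<Omega> f\<close> \<Omega> by (rule continuous_imp_measurable_on_sets_lebesgue)
  have "integrable lborel (\<lambda>x. indicator K x *\<^sub>R f x)"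
    using K \<open>continuous_on \<Omega> f\<close> by (intro borel_integrable_compact) (auto intro: continuous_on_subset)
  also have ind: "(\<lambda>x. indicator K x *\<^sub>R f x) = f"
    using K(3) by (auto simp: indicator_def)
  finally have int: "integrable lborel f" .
  have ind': "(\<lambda>x. indicator \<Omega> x *\<^sub>R f x) = f"
    using K(2,3) by (intro ext) (auto simp: indicator_def subset_iff)
  have "integrable lebesgue f"
    using int by (subst integrable_completion) auto
  then show "integrable (lebesgue_on \<Omega>) f"
    using \<Omega> by (subst integrable_restrict_space) (auto simp: ind')
  have "(LINT x|lebesgue_on \<Omega>. f x) = (LINT x|lebesgue. f x)"
    using \<Omega> by (subst integral_restrict_space) (auto simp: ind')
  also have "\<dots> = (LINT x|lborel. f x)"
    using int by (intro integral_completion) auto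
  finally show "(LINT x|lebesgue_on \<Omega>. f x) = (LINT x|lborel. f x)" .
qed

section \<open>The Schroedinger expression and its form on test functions\<close>

definition schroedinger ::
  "('a::euclidean_space \<Rightarrow> real) \<Rightarrow> ('a \<Rightarrow> complex) \<Rightarrow> 'a \<Rightarrow> complex" where
  "schroedinger V u = (\<lambda>x. - laplacian u x + complex_of_real (V x) * u x)"

lemma laplacian_add:
  assumes "smooth u" "smooth w"
  shows "laplacian (\<lambda>x. u x + w x) x = laplacian u x + laplacian w x"
  using assms by (simp add: laplacian_def dir_deriv_add smooth_differentiable smooth_dir_deriv
      sum.distrib)

lemma laplacian_scaleR:
  assumes "smooth u"
  shows "laplacian (\<lambda>x. c *\<^sub>R u x) x = c *\<^sub>R laplacian u x"
  using assms by (simp add: laplacian_def dir_deriv_scaleR smooth_differentiable smooth_dir_deriv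
      scaleR_sum_right)

lemma schroedinger_add:
  "smooth u \<Longrightarrow> smooth w \<Longrightarrow>
    schroedinger V (\<lambda>x. u x + w x) = (\<lambda>x. schroedinger V u x + schroedinger V w x)"
  by (simp add: schroedinger_def laplacian_add algebra_simps)

lemma schroedinger_scaleR:
  "smooth u \<Longrightarrow> schroedinger V (\<lambda>x. c *\<^sub>R u x) = (\<lambda>x. c *\<^sub>R schroedinger V u x)"
  by (simp add: schroedinger_def laplacian_scaleR algebra_simps)

lemma schroedinger_diff:
  assumes "smooth u" "smooth w"
  shows "schroedinger V (\<lambda>x. u x - w x) = (\<lambda>x. schroedinger V u x - schroedinger V w x)"
  using schroedinger_add[OF assms(1) smooth_scaleR[OF assms(2), of "-1"], of V]
    schroedinger_scaleR[OF assms(2), of V "-1"] by simp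

lemma schroedinger_sum:
  assumes "finite I" "\<And>i. i \<in> I \<Longrightarrow> u i \<in> test_functions \<Omega>"
  shows "schroedinger V (\<lambda>x. \<Sum>i\<in>I. u i x) = (\<lambda>x. \<Sum>i\<in>I. schroedinger V (u i) x)"
  using assms
proof (induction I rule: finite_induct)
  case empty
  then show ?case using schroedinger_scaleR[of "\<lambda>_. 0" V 0] by (simp add: smooth_def Ck_const)
next
  case (insert i I)
  then show ?case
    by (simp add: schroedinger_add test_functions_smooth[of _ \<Omega>] test_functions_sum)
qed

locale schroedinger_form =
  fixes \<Omega> :: "'a::euclidean_space set" and V :: "'a \<Rightarrow> real"
  assumes open_domain: "open \<Omega>"
    and continuous_potential: "continuous_on \<Omega> V"
    and energy_nonneg: "\<And>u. u \<in> test_functions \<Omega> \<Longrightarrow> 0 \<le> energy_form \<Omega> V u"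
begin

abbreviation M :: "'a measure" where "M \<equiv> lebesgue_on \<Omega>"

abbreviation D :: "('a \<Rightarrow> complex) set" where "D \<equiv> test_functions \<Omega>"

text \<open>Written through the operator, not through gradients: linearity and limits then come from
  \<open>L2_rinner\<close>, and the expression is the one in the adjoint relation. Symmetry is the
  price and is supplied by \<open>form_eq\<close>.\<close>

definition form :: "('a \<Rightarrow> complex) \<Rightarrow> ('a \<Rightarrow> complex) \<Rightarrow> real" where
  "form u v = L2_rinner M (schroedinger V u) v"

lemma L2_compact_support:
  assumes "compact K" "K \<subseteq> \<Omega>" "\<And>x. x \<notin> K \<Longrightarrow> f x = 0" "continuous_on \<Omega> f"
  shows "f \<in> L2 M"
proof -
  have "integrable M (\<lambda>x. (cmod (f x))\<^sup>2)"
    using assms open_domain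
    by (intro lebesgue_on_compact_support(2)[of K]) (auto intro!: continuous_intros)
  with lebesgue_on_compact_support(1)[OF assms(1-3) open_domain assms(4)] show ?thesis
    by (simp add: L2_def)
qed

lemma test_L2: "u \<in> D \<Longrightarrow> u \<in> L2 M"
  by (metis test_functionsD L2_compact_support test_functions_smooth smooth_imp_continuous
      continuous_on_subset subset_UNIV)

lemma continuous_laplacian: "smooth u \<Longrightarrow> continuous_on UNIV (laplacian u)"
  unfolding laplacian_def[abs_def]
  by (intro continuous_on_sum smooth_imp_continuous smooth_dir_deriv)

lemma schroedinger_L2:
  assumes u: "u \<in> D"
  shows "schroedinger V u \<in> L2 M"
proof -
  obtain K where K: "compact K" "K \<subseteq> \<Omega>" "\<And>x. x \<notin> K \<Longrightarrow> u x = 0"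
    "\<And>v v' x. x \<notin> K \<Longrightarrow> dir_deriv v (dir_deriv v' u) x = 0"
    using test_functionsD[OF u] by metis
  have s: "smooth u" using u by (rule test_functions_smooth)
  show ?thesis
  proof (rule L2_compact_support[OF K(1,2)])
    show "schroedinger V u x = 0" if "x \<notin> K" for x
      using that K by (simp add: schroedinger_def laplacian_def)
    show "continuous_on \<Omega> (schroedinger V u)"
      unfolding schroedinger_def
      using continuous_on_subset[OF continuous_laplacian[OF s]]
        continuous_on_subset[OF smooth_imp_continuous[OF s]] continuous_potential
      by (intro continuous_intros) auto
  qed
qed

text \<open>Integration by parts gives an expression symmetric in u and v; both the symmetry of the
  form and its agreement with \<open>energy_form\<close> are read off from it.\<close>

lemma form_eq:
  assumes u: "u \<in> D" and v: "v \<in> D"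
  shows "form u v = (LINT x|M. (\<Sum>b\<in>Basis. dir_deriv b u x \<bullet> dir_deriv b v x) + V x * (u x \<bullet> v x))"
proof -
  obtain K where K: "compact K" "K \<subseteq> \<Omega>" "\<And>x. x \<notin> K \<Longrightarrow> v x = 0" "\<And>b x. x \<notin> K \<Longrightarrow> dir_deriv b v x = 0"
    using test_functionsD[OF v] by metis
  have s: "smooth u" "smooth v" using u v by (auto intro: test_functions_smooth)
  have tU: "u \<in> test_functions UNIV" "v \<in> test_functions UNIV"
    using u v by (auto simp: test_functions_def)
  let ?a = "\<lambda>x. - laplacian u x \<bullet> v x" and ?b = "\<lambda>x. \<Sum>b\<in>Basis. dir_deriv b u x \<bullet> dir_deriv b v x"
    and ?c = "\<lambda>x. V x * (u x \<bullet> v x)"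
  have cont: "continuous_on \<Omega> u" "continuous_on \<Omega> v" "continuous_on \<Omega> (laplacian u)"
    using s by (auto intro: continuous_on_subset[OF smooth_imp_continuous] continuous_on_subset[OF continuous_laplacian])
  have cb: "continuous_on \<Omega> ?b"
    by (rule continuous_on_subset[OF _ subset_UNIV])
      (intro continuous_on_sum smooth_imp_continuous smooth_inner smooth_dir_deriv s)
  have ca: "continuous_on \<Omega> ?a" and cc: "continuous_on \<Omega> ?c"
    using cont continuous_potential by (auto intro!: continuous_intros)
  note supp = lebesgue_on_compact_support[OF K(1,2) _ open_domain]
  have a: "integrable M ?a" "(LINT x|M. ?a x) = (LINT x|lborel. ?a x)"
    using supp(2)[OF _ ca] supp(3)[OF _ ca] K(3) by auto
  have b: "integrable M ?b" "(LINT x|M. ?b x) = (LINT x|lborel. ?b x)"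
    using supp(2)[OF _ cb] supp(3)[OF _ cb] K(4) by auto
  have c: "integrable M ?c" using supp(2)[OF _ cc] K(3) by auto
  have "form u v = (LINT x|M. ?a x + ?c x)"
    unfolding form_def L2_rinner_def
    by (intro arg_cong[of _ _ "integral\<^sup>L M"] ext)
      (simp add: schroedinger_def inner_add_left inner_complex_def algebra_simps)
  also have "\<dots> = (LINT x|M. ?a x) + (LINT x|M. ?c x)" using a c by simp
  also have "(LINT x|M. ?a x) = (LINT x|M. ?b x)"
    using integral_by_parts[OF tU] a b by simp
  also have "(LINT x|M. ?b x) + (LINT x|M. ?c x) = (LINT x|M. ?b x + ?c x)" using b c by simp
  finally show ?thesis .
qed

lemma form_commute: "u \<in> D \<Longrightarrow> v \<in> D \<Longrightarrow> form u v = form v u"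
  by (simp add: form_eq inner_commute)

lemma form_self: "u \<in> D \<Longrightarrow> form u u = energy_form \<Omega> V u"
  by (simp add: form_eq energy_form_def grad_norm_sq_def power2_norm_eq_inner)

lemma form_nonneg: "u \<in> D \<Longrightarrow> 0 \<le> form u u"
  by (simp add: form_self energy_nonneg)

lemma form_add_left: "u \<in> D \<Longrightarrow> v \<in> D \<Longrightarrow> w \<in> D \<Longrightarrow> form (\<lambda>x. u x + v x) w = form u w + form v w"
  by (simp add: form_def schroedinger_add test_functions_smooth L2_rinner_add_left schroedinger_L2 test_L2)

lemma form_diff_left: "u \<in> D \<Longrightarrow> v \<in> D \<Longrightarrow> w \<in> D \<Longrightarrow> form (\<lambda>x. u x - v x) w = form u w - form v w"
  by (simp add: form_def schroedinger_diff test_functions_smooth L2_rinner_diff_left schroedinger_L2 test_L2)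

lemma form_scaleR_left: "u \<in> D \<Longrightarrow> form (\<lambda>x. c *\<^sub>R u x) w = c * form u w"
  by (simp add: form_def schroedinger_scaleR test_functions_smooth L2_rinner_scaleR_left)

lemma form_add_right: "u \<in> D \<Longrightarrow> v \<in> D \<Longrightarrow> w \<in> D \<Longrightarrow> form w (\<lambda>x. u x + v x) = form w u + form w v"
  by (simp add: form_def L2_rinner_add_right schroedinger_L2 test_L2)

lemma form_diff_right: "u \<in> D \<Longrightarrow> v \<in> D \<Longrightarrow> w \<in> D \<Longrightarrow> form w (\<lambda>x. u x - v x) = form w u - form w v"
  by (simp add: form_def L2_rinner_diff_right schroedinger_L2 test_L2)

lemma form_scaleR_right: "form w (\<lambda>x. c *\<^sub>R u x) = c * form w u"
  by (simp add: form_def L2_rinner_scaleR_right)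

lemma form_sum:
  assumes "finite I" "\<And>i. i \<in> I \<Longrightarrow> u i \<in> D"
  shows "form (\<lambda>x. \<Sum>i\<in>I. u i x) (\<lambda>x. \<Sum>i\<in>I. u i x) = (\<Sum>i\<in>I. \<Sum>j\<in>I. form (u i) (u j))"
  using assms unfolding form_def
  by (simp add: schroedinger_sum[of _ _ \<Omega>] L2_rinner_sum_left L2_rinner_sum_right schroedinger_L2
      test_L2 L2_sum)

lemma form_Cauchy_Schwarz:
  assumes u: "u \<in> D" and v: "v \<in> D"
  shows "(form u v)\<^sup>2 \<le> form u u * form v v"
proof (rule nonneg_quadratic_discriminant)
  fix t :: real
  have tv: "(\<lambda>x. t *\<^sub>R v x) \<in> D" using v by (rule test_functions_scaleR)
  have "0 \<le> form (\<lambda>x. u x + t *\<^sub>R v x) (\<lambda>x. u x + t *\<^sub>R v x)"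
    using u tv by (intro form_nonneg test_functions_add)
  also have "\<dots> = form u u + 2 * t * form u v + t\<^sup>2 * form v v"
    using u v tv by (simp add: form_add_left form_add_right test_functions_add form_scaleR_left
        form_scaleR_right form_commute[OF v u] power2_eq_square algebra_simps)
  finally show "0 \<le> form u u + 2 * t * form u v + t\<^sup>2 * form v v" .
qed

text \<open>The sequences occurring in \<open>form_domain\<close>, in terms of the real part of the form.\<close>

definition approx :: "(nat \<Rightarrow> 'a \<Rightarrow> complex) \<Rightarrow> ('a \<Rightarrow> complex) \<Rightarrow> bool" where
  "approx \<phi> u \<longleftrightarrow> (\<forall>n. \<phi> n \<in> D) \<and> (\<lambda>n. L2_norm M (\<lambda>x. \<phi> n x - u x)) \<longlonglongrightarrow> 0 \<and>
     (\<forall>e>0. \<exists>K. \<forall>m\<ge>K. \<forall>n\<ge>K. form (\<lambda>x. \<phi> m x - \<phi> n x) (\<lambda>x. \<phi> m x - \<phi> n x) < e)"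

text \<open>Reduces the complex graph conditions to real ones: take real parts in the adjoint
  relation, and bound the form of a difference, which is a real part, by the modulus that the form
  domain controls.\<close>

lemma S_opD:
  assumes "(u, f) \<in> S_op \<Omega> V"
  shows "u \<in> L2 M" "f \<in> L2 M" "\<And>\<phi>. \<phi> \<in> D \<Longrightarrow> L2_rinner M (schroedinger V \<phi>) u = L2_rinner M \<phi> f"
    "\<exists>\<phi>. approx \<phi> u"
proof -
  have adj: "(u, f) \<in> L2_adjoint M (S_min \<Omega> V)" and dom: "u \<in> form_domain M (S_min \<Omega> V)"
    using assms by (auto simp: S_op_def friedrichs_extension_def)
  show L: "u \<in> L2 M" "f \<in> L2 M" using adj by (auto simp: L2_adjoint_def)
  have min: "(\<phi>, h) \<in> S_min \<Omega> V \<longleftrightarrow> \<phi> \<in> D \<and> h = schroedinger V \<phi>" for \<phi> h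
    by (auto simp: S_min_def schroedinger_def)
  show "L2_rinner M (schroedinger V \<phi>) u = L2_rinner M \<phi> f" if "\<phi> \<in> D" for \<phi>
  proof -
    have "L2_inner M (schroedinger V \<phi>) u = L2_inner M \<phi> f"
      using adj min[of \<phi> "schroedinger V \<phi>"] that by (auto simp: L2_adjoint_def)
    then show ?thesis using L that by (simp add: Re_L2_inner[symmetric] schroedinger_L2 test_L2)
  qed
  obtain \<phi> h where \<phi>: "\<And>n. (\<phi> n, h n) \<in> S_min \<Omega> V"
      "(\<lambda>n. L2_norm M (\<lambda>x. \<phi> n x - u x)) \<longlonglongrightarrow> 0"
      "\<And>e. e > 0 \<Longrightarrow> \<exists>K. \<forall>m\<ge>K. \<forall>n\<ge>K. cmod (L2_inner M (\<lambda>x. h m x - h n x) (\<lambda>x. \<phi> m x - \<phi> n x)) < e"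
    using dom unfolding form_domain_def by blast
  have \<phi>D: "\<phi> n \<in> D" and h: "h n = schroedinger V (\<phi> n)" for n using \<phi>(1) min by blast+
  have "form (\<lambda>x. \<phi> m x - \<phi> n x) (\<lambda>x. \<phi> m x - \<phi> n x)
      \<le> cmod (L2_inner M (\<lambda>x. h m x - h n x) (\<lambda>x. \<phi> m x - \<phi> n x))" for m n
  proof -
    have "form (\<lambda>x. \<phi> m x - \<phi> n x) (\<lambda>x. \<phi> m x - \<phi> n x)
        = Re (L2_inner M (\<lambda>x. h m x - h n x) (\<lambda>x. \<phi> m x - \<phi> n x))"
      unfolding form_def using \<phi>D
      by (simp add: Re_L2_inner schroedinger_diff test_functions_smooth[of _ \<Omega>] h L2_diff schroedinger_L2 test_L2)
    then show ?thesis using complex_Re_le_cmod by metis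
  qed
  with \<phi> \<phi>D have "approx \<phi> u" unfolding approx_def by (meson le_less_trans)
  then show "\<exists>\<phi>. approx \<phi> u" by (intro exI[of _ \<phi>])
qed

lemma approx_Cauchy:
  assumes "approx \<phi> u" "e > 0"
  shows "\<exists>K. \<forall>m n. m \<ge> K \<longrightarrow> n \<ge> K \<longrightarrow> form (\<lambda>x. \<phi> m x - \<phi> n x) (\<lambda>x. \<phi> m x - \<phi> n x) < e"
  using assms unfolding approx_def by blast

lemma approx_form_bounded:
  assumes "approx \<phi> u"
  shows "\<exists>B K. B > 0 \<and> (\<forall>n\<ge>K. form (\<phi> n) (\<phi> n) \<le> B)"
proof -
  have D: "\<phi> n \<in> D" for n using assms by (simp add: approx_def)
  obtain K where K: "\<And>m n. m \<ge> K \<Longrightarrow> n \<ge> K \<Longrightarrow> form (\<lambda>x. \<phi> m x - \<phi> n x) (\<lambda>x. \<phi> m x - \<phi> n x) < 1"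
    using approx_Cauchy[OF assms zero_less_one] by auto
  show ?thesis
  proof (intro exI conjI allI impI)
    show "2 + 2 * form (\<phi> K) (\<phi> K) > 0" using form_nonneg[OF D, of K] by simp
    fix n assume "n \<ge> K"
    with K have "form (\<lambda>x. \<phi> n x - \<phi> K x) (\<lambda>x. \<phi> n x - \<phi> K x) < 1" by simp
    then have 1: "form (\<phi> n) (\<phi> n) - 2 * form (\<phi> n) (\<phi> K) + form (\<phi> K) (\<phi> K) < 1"
      using D by (simp add: form_diff_left form_diff_right test_functions_diff form_commute[of "\<phi> K" "\<phi> n"])
    \<comment> \<open>With x = \<phi> n and y = \<phi> K, this is the discarded term of the
      parallelogram law for x - y and y, which gives q(x) <= 2 q(x - y) + 2 q(y).\<close>
    have "0 \<le> form (\<lambda>x. \<phi> n x - 2 *\<^sub>R \<phi> K x) (\<lambda>x. \<phi> n x - 2 *\<^sub>R \<phi> K x)"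
      by (intro form_nonneg test_functions_diff test_functions_scaleR D)
    also have "\<dots> = form (\<phi> n) (\<phi> n) - 4 * form (\<phi> n) (\<phi> K) + 4 * form (\<phi> K) (\<phi> K)"
      using D by (simp add: form_diff_left form_diff_right test_functions_diff test_functions_scaleR
          form_scaleR_left form_scaleR_right form_commute[of "\<phi> K" "\<phi> n"])
    finally show "form (\<phi> n) (\<phi> n) \<le> 2 + 2 * form (\<phi> K) (\<phi> K)"
      using 1 by simp
  qed
qed

text \<open>For fixed n the limit in the second index is <\<phi> n, h>, by the adjoint relation.
  Cauchy-Schwarz for the form, with \<open>form (\<phi> n) (\<phi> n)\<close> bounded and \<psi>
  form-Cauchy, makes this limit uniform in n, so the diagonal sequence has the limit of <\<phi> n,
  h>.\<close>

lemma approx_form_tendsto: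
  assumes u: "approx \<phi> u" "u \<in> L2 M" and v: "(v, h) \<in> S_op \<Omega> V" "approx \<psi> v"
  shows "(\<lambda>n. form (\<phi> n) (\<psi> n)) \<longlonglongrightarrow> L2_rinner M u h"
proof -
  have D: "\<phi> n \<in> D" "\<psi> n \<in> D" for n using u v by (simp_all add: approx_def)
  note S = S_opD(1-3)[OF v(1)]
  obtain B K where B: "\<And>n. n \<ge> K \<Longrightarrow> form (\<phi> n) (\<phi> n) \<le> B" "B > 0"
    using approx_form_bounded[OF u(1)] by auto
  have const: "((\<lambda>n. L2_norm M (\<lambda>x. f x - f x)) \<longlongrightarrow> 0) sequentially" for f
    by (simp add: L2_norm_def)
  have u_lim: "(\<lambda>n. L2_norm M (\<lambda>x. \<phi> n x - u x)) \<longlonglongrightarrow> 0"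
    and v_lim: "(\<lambda>n. L2_norm M (\<lambda>x. \<psi> n x - v x)) \<longlonglongrightarrow> 0" using u v by (simp_all add: approx_def)
  have 1: "(\<lambda>n. L2_rinner M (\<phi> n) h) \<longlonglongrightarrow> L2_rinner M u h"
    by (rule tendsto_L2_rinner[OF u_lim const]) (use D S u in \<open>auto simp: test_L2\<close>)
  have 2: "(\<lambda>k. form (\<phi> n) (\<psi> k)) \<longlonglongrightarrow> L2_rinner M (\<phi> n) h" for n
  proof -
    have "(\<lambda>k. form (\<phi> n) (\<psi> k)) \<longlonglongrightarrow> L2_rinner M (schroedinger V (\<phi> n)) v"
      unfolding form_def
      by (rule tendsto_L2_rinner[OF const v_lim]) (use D S in \<open>auto simp: test_L2 schroedinger_L2\<close>)
    then show ?thesis using S(3) D by simp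
  qed
  have "(\<lambda>n. form (\<phi> n) (\<psi> n) - L2_rinner M (\<phi> n) h) \<longlonglongrightarrow> 0"
  proof (rule LIMSEQ_I)
    fix e :: real assume e: "e > 0"
    \<comment> \<open>Chosen so that the Cauchy-Schwarz product B d is the square of e / 2.\<close>
    define d where "d = (e / 2)\<^sup>2 / B"
    have "d > 0" using e B by (simp add: d_def)
    then obtain L where L: "\<And>m n. m \<ge> L \<Longrightarrow> n \<ge> L \<Longrightarrow> form (\<lambda>x. \<psi> m x - \<psi> n x) (\<lambda>x. \<psi> m x - \<psi> n x) < d"
      using approx_Cauchy[OF v(2)] by meson
    have "norm (form (\<phi> n) (\<psi> n) - L2_rinner M (\<phi> n) h - 0) < e" if n: "n \<ge> max K L" for n
    proof -
      have "\<bar>form (\<phi> n) (\<psi> n) - form (\<phi> n) (\<psi> k)\<bar> \<le> e / 2" if "k \<ge> L" for k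
      proof (rule abs_le_square_iff[THEN iffD2, of _ "e / 2", simplified abs_of_nonneg[OF less_imp_le[OF half_gt_zero[OF e]]]])
        have "(form (\<phi> n) (\<psi> n) - form (\<phi> n) (\<psi> k))\<^sup>2 = (form (\<phi> n) (\<lambda>x. \<psi> n x - \<psi> k x))\<^sup>2"
          using D by (simp add: form_diff_right)
        also have "\<dots> \<le> form (\<phi> n) (\<phi> n) * form (\<lambda>x. \<psi> n x - \<psi> k x) (\<lambda>x. \<psi> n x - \<psi> k x)"
          by (intro form_Cauchy_Schwarz test_functions_diff D)
        also have "\<dots> \<le> B * d"
          using n that B L[of n k] D
          by (intro mult_mono) (auto intro!: form_nonneg test_functions_diff simp: less_imp_le)
        also have "\<dots> = (e / 2)\<^sup>2" using B by (simp add: d_def)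
        finally show "(form (\<phi> n) (\<psi> n) - form (\<phi> n) (\<psi> k))\<^sup>2 \<le> (e / 2)\<^sup>2" .
      qed
      moreover have "(\<lambda>k. \<bar>form (\<phi> n) (\<psi> n) - form (\<phi> n) (\<psi> k)\<bar>) \<longlonglongrightarrow> \<bar>form (\<phi> n) (\<psi> n) - L2_rinner M (\<phi> n) h\<bar>"
        by (intro tendsto_intros 2)
      ultimately have "\<bar>form (\<phi> n) (\<psi> n) - L2_rinner M (\<phi> n) h\<bar> \<le> e / 2"
        by (intro LIMSEQ_le_const2) auto
      with e show ?thesis by simp
    qed
    then show "\<exists>N. \<forall>n\<ge>N. norm (form (\<phi> n) (\<psi> n) - L2_rinner M (\<phi> n) h - 0) < e" by blast
  qed
  from tendsto_add[OF this 1] show ?thesis by simp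
qed

text \<open>Both sides are limits of the form along the same two sequences, with the arguments
  interchanged.\<close>

lemma S_op_symmetric:
  assumes "(u, f) \<in> S_op \<Omega> V" "(v, h) \<in> S_op \<Omega> V"
  shows "L2_rinner M f v = L2_rinner M u h"
proof -
  obtain \<phi> \<psi> where a: "approx \<phi> u" "approx \<psi> v" using assms S_opD(4) by blast
  have "(\<lambda>n. form (\<phi> n) (\<psi> n)) \<longlonglongrightarrow> L2_rinner M u h"
    by (rule approx_form_tendsto[OF a(1) S_opD(1)[OF assms(1)] assms(2) a(2)])
  moreover have "(\<lambda>n. form (\<psi> n) (\<phi> n)) \<longlonglongrightarrow> L2_rinner M v f"
    by (rule approx_form_tendsto[OF a(2) S_opD(1)[OF assms(2)] assms(1) a(1)])
  moreover have "form (\<psi> n) (\<phi> n) = form (\<phi> n) (\<psi> n)" for n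
    using a by (intro form_commute) (simp_all add: approx_def)
  ultimately show ?thesis using LIMSEQ_unique by (simp add: L2_rinner_commute)
qed

text \<open>Approximate every \<open>u i\<close> by test functions, apply the bound to their sum and
  let the common index tend to infinity. Stated as a double sum, it stays with the given graph pairs
  and never forms the sum as a new element of the domain.\<close>

lemma S_op_sum_bound:
  assumes I: "finite I" and S: "\<And>i. i \<in> I \<Longrightarrow> (u i, f i) \<in> S_op \<Omega> V" and g: "g \<in> L2 M"
    and bound: "\<And>\<phi>. \<phi> \<in> D \<Longrightarrow> (L2_rinner M g \<phi>)\<^sup>2 \<le> C * form \<phi> \<phi>"
  shows "(\<Sum>i\<in>I. L2_rinner M g (u i))\<^sup>2 \<le> C * (\<Sum>i\<in>I. \<Sum>j\<in>I. L2_rinner M (u i) (f j))"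
proof -
  have "\<forall>i\<in>I. \<exists>\<phi>. approx \<phi> (u i)" using S S_opD(4) by blast
  then obtain \<phi> where \<phi>: "\<And>i. i \<in> I \<Longrightarrow> approx (\<phi> i) (u i)" by metis
  have D: "\<phi> i n \<in> D" if "i \<in> I" for i n using \<phi>[OF that] by (simp add: approx_def)
  have lim: "(\<lambda>n. L2_rinner M g (\<phi> i n)) \<longlonglongrightarrow> L2_rinner M g (u i)" if "i \<in> I" for i
  proof (rule tendsto_L2_rinner)
    show "(\<lambda>n. L2_norm M (\<lambda>x. \<phi> i n x - u i x)) \<longlonglongrightarrow> 0" using \<phi>[OF that] by (simp add: approx_def)
  qed (use that g D S_opD(1)[OF S] in \<open>auto simp: L2_norm_def intro!: test_L2 always_eventually\<close>)
  have "(\<Sum>i\<in>I. L2_rinner M g (\<phi> i n))\<^sup>2 \<le> C * (\<Sum>i\<in>I. \<Sum>j\<in>I. form (\<phi> i n) (\<phi> j n))" for n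
  proof -
    have "(\<Sum>i\<in>I. L2_rinner M g (\<phi> i n)) = L2_rinner M g (\<lambda>x. \<Sum>i\<in>I. \<phi> i n x)"
      using D g by (simp add: L2_rinner_sum_right test_L2)
    also have "\<dots>\<^sup>2 \<le> C * form (\<lambda>x. \<Sum>i\<in>I. \<phi> i n x) (\<lambda>x. \<Sum>i\<in>I. \<phi> i n x)"
      using D by (intro bound test_functions_sum)
    also have "form (\<lambda>x. \<Sum>i\<in>I. \<phi> i n x) (\<lambda>x. \<Sum>i\<in>I. \<phi> i n x) = (\<Sum>i\<in>I. \<Sum>j\<in>I. form (\<phi> i n) (\<phi> j n))"
      using I D by (rule form_sum)
    finally show ?thesis .
  qed
  moreover have "(\<lambda>n. (\<Sum>i\<in>I. L2_rinner M g (\<phi> i n))\<^sup>2) \<longlonglongrightarrow> (\<Sum>i\<in>I. L2_rinner M g (u i))\<^sup>2"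
    by (intro tendsto_intros lim)
  moreover have "(\<lambda>n. C * (\<Sum>i\<in>I. \<Sum>j\<in>I. form (\<phi> i n) (\<phi> j n)))
      \<longlonglongrightarrow> C * (\<Sum>i\<in>I. \<Sum>j\<in>I. L2_rinner M (u i) (f j))"
    using approx_form_tendsto[OF \<phi> S_opD(1)[OF S] S \<phi>] by (intro tendsto_intros) auto
  ultimately show ?thesis by (intro LIMSEQ_le) auto
qed

text \<open>Since g vanishes off a compact set K, <g, u> is the scalar product of the indicator of K
  with the product of g and the conjugate of u. Cauchy-Schwarz leaves the weighted integral that
  subcriticality controls.\<close>

lemma subcritical_form_bound:
  assumes "subcritical \<Omega> V" and g: "g \<in> D"
  obtains C where "C > 0" "\<And>u. u \<in> D \<Longrightarrow> (L2_rinner M g u)\<^sup>2 \<le> C * form u u"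
proof -
  let ?W = "\<lambda>x. (cmod (g x))\<^sup>2"
  have "?W \<in> test_functions \<Omega> \<and> (\<forall>x. 0 \<le> ?W x)"
    using test_functions_norm_sq[OF g] by simp
  with assms(1)[unfolded subcritical_def, rule_format, of ?W]
  have "\<exists>\<delta>>0. \<forall>u\<in>D. \<delta> * (LINT x|M. ?W x * (cmod (u x))\<^sup>2) \<le> energy_form \<Omega> V u" by blast
  then obtain \<delta> where \<delta>: "\<delta> > 0"
    "\<And>u. u \<in> D \<Longrightarrow> \<delta> * (LINT x|M. (cmod (g x))\<^sup>2 * (cmod (u x))\<^sup>2) \<le> form u u"
    using form_self by auto
  obtain K where K: "compact K" "K \<subseteq> \<Omega>" "\<And>x. x \<notin> K \<Longrightarrow> g x = 0"
    using test_functionsD[OF g] by metis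
  define k :: "'a \<Rightarrow> complex" where "k = indicator K"
  have meas: "K \<in> sets lebesgue" using K(1) by (simp add: compact_imp_closed lmeasurable_compact fmeasurableD)
  have kL: "k \<in> L2 M"
  proof -
    have "integrable lborel (\<lambda>x. indicator K x *\<^sub>R (1::real))"
      by (rule borel_integrable_compact[OF K(1)]) auto
    then have "integrable lebesgue (indicator K :: 'a \<Rightarrow> real)"
      by (subst integrable_completion) auto
    moreover have "(\<lambda>x. indicator \<Omega> x *\<^sub>R indicator K x) = (indicator K :: 'a \<Rightarrow> real)"
      using K(2) by (intro ext) (simp add: indicator_def subset_iff)
    ultimately have "integrable M (indicator K :: 'a \<Rightarrow> real)"
      using open_domain by (subst integrable_restrict_space) simp_all
    moreover have "(\<lambda>x. (cmod (k x))\<^sup>2) = indicator K" by (auto simp: k_def indicator_def)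
    moreover have "k \<in> borel_measurable M"
      unfolding k_def using meas K(2) open_domain
      by (intro borel_measurable_indicator) (auto simp: sets_restrict_space_iff)
    ultimately show ?thesis by (simp add: L2_def)
  qed
  \<comment> \<open>The measure of K divided by \<delta>; adding 1 keeps C positive even if K is a
    null set.\<close>
  define C where "C = L2_rinner M k k / \<delta> + 1"
  have "(L2_rinner M g u)\<^sup>2 \<le> C * form u u" if u: "u \<in> D" for u
  proof -
    let ?p = "\<lambda>x. g x * cnj (u x)"
    have c: "continuous_on \<Omega> g" "continuous_on \<Omega> u"
      using g u by (auto intro: continuous_on_subset[OF smooth_imp_continuous] test_functions_smooth)
    have pL: "?p \<in> L2 M"
      using K c by (intro L2_compact_support[OF K(1,2)]) (auto intro!: continuous_intros)
    have "L2_rinner M g u = L2_rinner M k ?p"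
      unfolding L2_rinner_def using K(3)
      by (intro arg_cong[of _ _ "integral\<^sup>L M"] ext) (auto simp: k_def indicator_def inner_complex_def)
    then have "(L2_rinner M g u)\<^sup>2 = \<bar>L2_rinner M k ?p\<bar>\<^sup>2" by simp
    also have "\<dots> \<le> (L2_norm M k * L2_norm M ?p)\<^sup>2"
      by (intro power_mono L2_Cauchy_Schwarz kL pL) auto
    also have "\<dots> = L2_rinner M k k * L2_rinner M ?p ?p"
      by (simp add: power_mult_distrib L2_norm_power2)
    also have "L2_rinner M ?p ?p = (LINT x|M. (cmod (g x))\<^sup>2 * (cmod (u x))\<^sup>2)"
      by (simp add: L2_rinner_def power2_norm_eq_inner[symmetric] norm_mult power_mult_distrib)
    also have "\<dots> \<le> form u u / \<delta>" using \<delta>(1) \<delta>(2)[OF u] by (simp add: field_simps)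
    also have "L2_rinner M k k * (form u u / \<delta>) \<le> C * form u u"
      using form_nonneg[OF u] by (simp add: C_def algebra_simps)
    finally show ?thesis by (simp add: mult_left_mono L2_rinner_nonneg)
  qed
  moreover have "C > 0" using \<delta>(1) L2_rinner_nonneg[of M k] by (simp add: C_def add_nonneg_pos)
  ultimately show thesis using that by blast
qed

end

section \<open>Energy identities and Riemann sums\<close>

text \<open>On each cell the mean value theorem writes the increment of G as cell length times a
  value of f, within e of the value at the left endpoint. The error depends on f only through its
  oscillation, so it is uniform over families of functions.\<close>

lemma riemann_sum_antiderivative_bound:
  fixes G f :: "real \<Rightarrow> real"
  assumes n: "n > 0" and T: "0 < T"
    and G: "\<And>x. x \<in> {0..T} \<Longrightarrow> (G has_real_derivative f x) (at x within {0..T})"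
    and osc: "\<And>x y. x \<in> {0..T} \<Longrightarrow> y \<in> {0..T} \<Longrightarrow> \<bar>x - y\<bar> \<le> T / real n \<Longrightarrow> \<bar>f x - f y\<bar> \<le> e"
  shows "\<bar>(\<Sum>i<n. T / real n * f (real i * (T / real n))) - (G T - G 0)\<bar> \<le> e * T"
proof -
  define c where "c = T / real n"
  have c: "c > 0" "real n * c = T" using n T by (auto simp: c_def)
  have cell: "\<bar>c * f (real i * c) - (G (real (Suc i) * c) - G (real i * c))\<bar> \<le> e * c" if "i < n" for i
  proof -
    have "real (Suc i) * c \<le> real n * c" using that c by (intro mult_right_mono) auto
    then have le: "0 \<le> real i * c" "real i * c < real (Suc i) * c" "real (Suc i) * c \<le> T"
      using c by (auto simp: algebra_simps)
    have "(G has_derivative (*) (f x)) (at x within {real i * c..real (Suc i) * c})"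
      if "real i * c \<le> x" "x \<le> real (Suc i) * c" for x
      using has_field_derivative_subset[OF G, of x "{real i * c..real (Suc i) * c}"] that le
      by (auto simp: has_field_derivative_def)
    from mvt_simple[OF le(2) this] obtain x where x: "x \<in> {real i * c<..<real (Suc i) * c}"
      "G (real (Suc i) * c) - G (real i * c) = f x * (real (Suc i) * c - real i * c)" by auto
    have "c * f (real i * c) - (G (real (Suc i) * c) - G (real i * c)) = (f (real i * c) - f x) * c"
      unfolding x(2) by (simp add: algebra_simps)
    moreover have "\<bar>f (real i * c) - f x\<bar> \<le> e"
    proof (rule osc)
      show "real i * c \<in> {0..T}" "x \<in> {0..T}" using x(1) le by auto
      show "\<bar>real i * c - x\<bar> \<le> T / real n"
        using x(1) by (simp add: c_def[symmetric] algebra_simps)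
    qed
    ultimately show ?thesis using c(1) by (simp add: abs_mult mult_right_mono)
  qed
  have "G T - G 0 = (\<Sum>i<n. G (real (Suc i) * c) - G (real i * c))"
    using sum_lessThan_telescope[of "\<lambda>i. G (real i * c)" n] c by simp
  then have "\<bar>(\<Sum>i<n. c * f (real i * c)) - (G T - G 0)\<bar>
      = \<bar>\<Sum>i<n. c * f (real i * c) - (G (real (Suc i) * c) - G (real i * c))\<bar>"
    by (simp add: sum_subtractf)
  also have "\<dots> \<le> (\<Sum>i<n. \<bar>c * f (real i * c) - (G (real (Suc i) * c) - G (real i * c))\<bar>)"
    by (rule sum_abs)
  also have "\<dots> \<le> (\<Sum>i<n. e * c)" using cell by (intro sum_mono) auto
  also have "\<dots> = e * T" using c by (simp add: mult.assoc flip: mult.left_commute)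
  finally show ?thesis by (simp add: c_def)
qed

definition riemann_sum :: "real \<Rightarrow> nat \<Rightarrow> (real \<Rightarrow> real) \<Rightarrow> real" where
  "riemann_sum T n f = (\<Sum>i<n. T / real n * f (real i * (T / real n)))"

lemma riemann_sum_tendsto:
  fixes G f :: "real \<Rightarrow> real"
  assumes T: "0 < T"
    and G: "\<And>x. x \<in> {0..T} \<Longrightarrow> (G has_real_derivative f x) (at x within {0..T})"
    and f: "continuous_on {0..T} f"
  shows "(\<lambda>n. riemann_sum T n f) \<longlonglongrightarrow> G T - G 0"
proof (rule LIMSEQ_I)
  fix e :: real assume e: "e > 0"
  have "uniformly_continuous_on {0..T} f" using f by (intro compact_uniformly_continuous) auto
  moreover have "e / (2 * T) > 0" using e T by simp
  ultimately obtain d where d: "d > 0"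
    "\<And>x y. x \<in> {0..T} \<Longrightarrow> y \<in> {0..T} \<Longrightarrow> dist y x < d \<Longrightarrow> dist (f y) (f x) < e / (2 * T)"
    unfolding uniformly_continuous_on_def by meson
  have "(\<lambda>n. T / real n) \<longlonglongrightarrow> 0" by (rule lim_const_over_n)
  then have "\<forall>\<^sub>F n in sequentially. T / real n < d" using d(1) by (rule order_tendstoD)
  then obtain N where N: "\<And>n. n \<ge> N \<Longrightarrow> T / real n < d" by (auto simp: eventually_sequentially)
  have "norm (riemann_sum T n f - (G T - G 0)) < e" if "n \<ge> max N 1" for n
  proof -
    have "\<bar>riemann_sum T n f - (G T - G 0)\<bar> \<le> e / (2 * T) * T"
      unfolding riemann_sum_def
    proof (rule riemann_sum_antiderivative_bound[OF _ T G])
      show "\<bar>f x - f y\<bar> \<le> e / (2 * T)" if "x \<in> {0..T}" "y \<in> {0..T}" "\<bar>x - y\<bar> \<le> T / real n" for x y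
        using d(2)[of y x] that N[of n] \<open>n \<ge> max N 1\<close> by (simp add: dist_real_def)
    qed (use that in auto)
    then show ?thesis using e T by simp
  qed
  then show "\<exists>N. \<forall>n\<ge>N. norm (riemann_sum T n f - (G T - G 0)) < e" by blast
qed

text \<open>Uniform continuity on the square makes the error of the inner sums uniform in y, so the
  outer sum preserves it. Both sums share the same nodes because the double sum arises from squaring
  a single one.\<close>

lemma riemann_sum_iterated_diff_tendsto:
  fixes h :: "real \<times> real \<Rightarrow> real" and G :: "real \<Rightarrow> real \<Rightarrow> real"
  assumes T: "0 < T"
    and G: "\<And>x y. x \<in> {0..T} \<Longrightarrow> y \<in> {0..T} \<Longrightarrow> (G y has_real_derivative h (x, y)) (at x within {0..T})"
    and h: "continuous_on ({0..T} \<times> {0..T}) h"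
  shows "(\<lambda>n. riemann_sum T n (\<lambda>y. riemann_sum T n (\<lambda>x. h (x, y))) - riemann_sum T n (\<lambda>y. G y T - G y 0)) \<longlonglongrightarrow> 0"
proof (rule LIMSEQ_I)
  fix e :: real assume e: "e > 0"
  have "uniformly_continuous_on ({0..T} \<times> {0..T}) h"
    using h by (intro compact_uniformly_continuous compact_Times) auto
  \<comment> \<open>Each of the two sums multiplies the oscillation by T, which leaves a total error
    of e / 2.\<close>
  moreover have "e / (2 * T * T) > 0" using e T by simp
  ultimately obtain d where d: "d > 0"
    "\<And>p q. p \<in> {0..T} \<times> {0..T} \<Longrightarrow> q \<in> {0..T} \<times> {0..T} \<Longrightarrow> dist q p < d \<Longrightarrow> dist (h q) (h p) < e / (2 * T * T)"
    unfolding uniformly_continuous_on_def by meson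
  have "(\<lambda>n. T / real n) \<longlonglongrightarrow> 0" by (rule lim_const_over_n)
  then have "\<forall>\<^sub>F n in sequentially. T / real n < d" using d(1) by (rule order_tendstoD)
  then obtain N where N: "\<And>n. n \<ge> N \<Longrightarrow> T / real n < d" by (auto simp: eventually_sequentially)
  have "norm (riemann_sum T n (\<lambda>y. riemann_sum T n (\<lambda>x. h (x, y))) - riemann_sum T n (\<lambda>y. G y T - G y 0) - 0) < e"
    if n: "n \<ge> max N 1" for n
  proof -
    let ?t = "\<lambda>j. real j * (T / real n)"
    let ?e = "e / (2 * T * T)"
    have inner: "\<bar>riemann_sum T n (\<lambda>x. h (x, y)) - (G y T - G y 0)\<bar> \<le> ?e * T" if y: "y \<in> {0..T}" for y
      unfolding riemann_sum_def
    proof (rule riemann_sum_antiderivative_bound[OF _ T G])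
      show "\<bar>h (x, y) - h (x', y)\<bar> \<le> ?e" if "x \<in> {0..T}" "x' \<in> {0..T}" "\<bar>x - x'\<bar> \<le> T / real n" for x x'
        using d(2)[of "(x', y)" "(x, y)"] that y N[of n] n by (simp add: dist_real_def dist_Pair_Pair)
    qed (use n y in auto)
    have t: "?t j \<in> {0..T}" if "j < n" for j
      using that T by (auto simp: field_simps)
    have "\<bar>riemann_sum T n (\<lambda>y. riemann_sum T n (\<lambda>x. h (x, y))) - riemann_sum T n (\<lambda>y. G y T - G y 0)\<bar>
        = \<bar>\<Sum>j<n. T / real n * (riemann_sum T n (\<lambda>x. h (x, ?t j)) - (G (?t j) T - G (?t j) 0))\<bar>"
      unfolding riemann_sum_def[of T n "\<lambda>y. G y T - G y 0"]
        riemann_sum_def[of T n "\<lambda>y. riemann_sum T n (\<lambda>x. h (x, y))"]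
      by (simp only: sum_subtractf[symmetric] right_diff_distrib[symmetric])
    also have "\<dots> \<le> (\<Sum>j<n. \<bar>T / real n * (riemann_sum T n (\<lambda>x. h (x, ?t j)) - (G (?t j) T - G (?t j) 0))\<bar>)"
      by (rule sum_abs)
    also have "\<dots> \<le> (\<Sum>j<n. T / real n * (?e * T))"
    proof (rule sum_mono)
      fix j assume "j \<in> {..<n}"
      with inner[OF t, of j] T
      show "\<bar>T / real n * (riemann_sum T n (\<lambda>x. h (x, ?t j)) - (G (?t j) T - G (?t j) 0))\<bar> \<le> T / real n * (?e * T)"
        unfolding abs_mult by (intro mult_mono) auto
    qed
    also have "\<dots> = e / 2" using n T by simp
    finally show ?thesis using e by simp
  qed
  then show "\<exists>N. \<forall>n\<ge>N. norm (riemann_sum T n (\<lambda>y. riemann_sum T n (\<lambda>x. h (x, y))) - riemann_sum T n (\<lambda>y. G y T - G y 0) - 0) < e" by blast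
qed

section \<open>Scalar products along a solution of the wave equation\<close>

locale wave = schroedinger_form +
  fixes g :: "'a \<Rightarrow> complex" and w w1 w2 :: "real \<Rightarrow> 'a \<Rightarrow> complex"
  assumes g: "g \<in> D"
    and L2: "\<And>t. t \<ge> 0 \<Longrightarrow> w t \<in> L2 M" "\<And>t. t \<ge> 0 \<Longrightarrow> w1 t \<in> L2 M" "\<And>t. t \<ge> 0 \<Longrightarrow> w2 t \<in> L2 M"
    and deriv: "has_L2_deriv M w w1" "has_L2_deriv M w1 w2"
    and cont: "L2_continuous M w2"
    and eqn: "\<And>t. t \<ge> 0 \<Longrightarrow> (w t, \<lambda>x. - w2 t x) \<in> S_op \<Omega> V"
    and init: "AE x in M. w 0 x = 0" "AE x in M. w1 0 x = g x"
begin

lemma g_L2: "g \<in> L2 M"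
  by (rule test_L2[OF g])

text \<open>The one-dimensional wave equation for <w(s), w(t)>: the symmetry of S with S w = - w''
  inserted on both sides.\<close>

lemma w2_symmetric:
  assumes "s \<ge> 0" "t \<ge> 0"
  shows "L2_rinner M (w2 s) (w t) = L2_rinner M (w s) (w2 t)"
  using S_op_symmetric[OF eqn[OF assms(1)] eqn[OF assms(2)]]
  by (simp add: L2_rinner_uminus_left L2_rinner_commute[of M "w s"])

text \<open>The initial conditions hold almost everywhere, so they are used only inside scalar
  products.\<close>

lemma w_0: "f \<in> L2 M \<Longrightarrow> L2_rinner M (w 0) f = 0"
  using L2_rinner_cong_AE[OF init(1) L2(1) L2_zero] by (simp add: L2_rinner_def)

lemma w1_0: "f \<in> L2 M \<Longrightarrow> L2_rinner M (w1 0) f = L2_rinner M g f"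
  using L2_rinner_cong_AE[OF init(2) L2(2) g_L2] by simp

lemma deriv_affine:
  assumes "e \<noteq> 0" "\<And>s. s \<in> S \<Longrightarrow> 0 \<le> c + e * s" "t \<in> S"
  shows "L2_deriv_at M (\<lambda>s. w (c + e * s)) (\<lambda>x. e *\<^sub>R w1 (c + e * t) x) t S"
    "L2_deriv_at M (\<lambda>s. w1 (c + e * s)) (\<lambda>x. e *\<^sub>R w2 (c + e * t) x) t S"
  using assms deriv L2 by (auto intro!: has_L2_deriv_affine)

lemma deriv_affine_rinner:
  fixes e e' :: real
  assumes "e \<noteq> 0" "\<And>s. s \<in> S \<Longrightarrow> 0 \<le> c + e * s" "e' \<noteq> 0" "\<And>s. s \<in> S \<Longrightarrow> 0 \<le> c' + e' * s" "t \<in> S"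
  shows "((\<lambda>s. L2_rinner M (w1 (c + e * s)) (w (c' + e' * s))) has_real_derivative
     e * L2_rinner M (w2 (c + e * t)) (w (c' + e' * t)) + e' * L2_rinner M (w1 (c + e * t)) (w1 (c' + e' * t)))
     (at t within S)"
  using L2_deriv_at_rinner[OF deriv_affine(2)[OF assms(1,2,5)] deriv_affine(1)[OF assms(3-5)]]
  by (simp add: L2_rinner_scaleR_left L2_rinner_scaleR_right)

definition a :: "real \<Rightarrow> real" where "a t = L2_rinner M g (w t)"

text \<open>With \<open>F(s, t) = \<langle>w(s), w(t)\<rangle>\<close> one has \<open>F\<^sub>s\<^sub>s = F\<^sub>t\<^sub>t\<close>; hence \<open>F\<^sub>s + F\<^sub>t\<close> and \<open>F\<^sub>s - F\<^sub>t\<close> are constant along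
  the characteristics \<open>s + t = const\<close> and \<open>s - t = const\<close>.\<close>

lemma rinner_sum:
  assumes "0 \<le> s" "0 \<le> t"
  shows "L2_rinner M (w1 s) (w t) + L2_rinner M (w1 t) (w s) = a (s + t)"
proof -
  \<comment> \<open>The sum F_s + F_t at the point (r, s + t - r), moving along a characteristic
    from r = 0, where the initial data give a(s + t), to r = s. The shape \<open>0 + 1 * r\<close>
    fits the affine chain rule.\<close>
  let ?f = "\<lambda>r. L2_rinner M (w1 (0 + 1 * r)) (w (s + t + (-1) * r)) + L2_rinner M (w1 (s + t + (-1) * r)) (w (0 + 1 * r))"
  have "(?f has_real_derivative 0) (at r within {0..s + t})" if "r \<in> {0..s + t}" for r
  proof -
    let ?u = "0 + 1 * r" and ?v = "s + t + (-1) * r"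
    have "(?f has_real_derivative
      (1 * L2_rinner M (w2 ?u) (w ?v) + (-1) * L2_rinner M (w1 ?u) (w1 ?v)) +
      ((-1) * L2_rinner M (w2 ?v) (w ?u) + 1 * L2_rinner M (w1 ?v) (w1 ?u))) (at r within {0..s + t})"
      using that by (intro derivative_intros deriv_affine_rinner) auto
    moreover have "L2_rinner M (w2 ?u) (w ?v) = L2_rinner M (w2 ?v) (w ?u)"
      using that by (subst w2_symmetric) (auto simp: L2_rinner_commute)
    moreover have "L2_rinner M (w1 ?u) (w1 ?v) = L2_rinner M (w1 ?v) (w1 ?u)"
      by (rule L2_rinner_commute)
    ultimately show ?thesis by simp
  qed
  from has_field_derivative_zero_constant[OF convex_real_interval(5) this]
  obtain c where "\<And>r. r \<in> {0..s + t} \<Longrightarrow> ?f r = c" by blast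
  from this[of s] this[of 0] assms have "?f s = ?f 0" by simp
  then show ?thesis using assms L2
    by (simp add: w1_0 a_def L2_rinner_commute[of M _ "w 0"] w_0)
qed

lemma rinner_diff:
  assumes "0 \<le> t" "t \<le> s"
  shows "L2_rinner M (w1 s) (w t) - L2_rinner M (w1 t) (w s) = - a (s - t)"
proof -
  let ?f = "\<lambda>r. L2_rinner M (w1 (s - t + 1 * r)) (w (0 + 1 * r)) - L2_rinner M (w1 (0 + 1 * r)) (w (s - t + 1 * r))"
  have "(?f has_real_derivative 0) (at r within {0..t})" if "r \<in> {0..t}" for r
  proof -
    let ?u = "s - t + 1 * r" and ?v = "0 + 1 * r"
    have "(?f has_real_derivative
      (1 * L2_rinner M (w2 ?u) (w ?v) + 1 * L2_rinner M (w1 ?u) (w1 ?v)) -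
      (1 * L2_rinner M (w2 ?v) (w ?u) + 1 * L2_rinner M (w1 ?v) (w1 ?u))) (at r within {0..t})"
      using that assms by (intro derivative_intros deriv_affine_rinner) auto
    moreover have "L2_rinner M (w2 ?u) (w ?v) = L2_rinner M (w2 ?v) (w ?u)"
      using that assms by (subst w2_symmetric) (auto simp: L2_rinner_commute)
    moreover have "L2_rinner M (w1 ?u) (w1 ?v) = L2_rinner M (w1 ?v) (w1 ?u)"
      by (rule L2_rinner_commute)
    ultimately show ?thesis by simp
  qed
  from has_field_derivative_zero_constant[OF convex_real_interval(5) this]
  obtain c where "\<And>r. r \<in> {0..t} \<Longrightarrow> ?f r = c" by blast
  \<comment> \<open>This characteristic meets the axis at (s - t, 0), inside the quadrant because t
    <= s; there w(0) = 0 leaves only - a(s - t).\<close>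
  from this[of t] this[of 0] assms have "?f t = ?f 0" by simp
  then show ?thesis using assms L2
    by (simp add: w1_0 a_def L2_rinner_commute[of M _ "w 0"] w_0)
qed

lemma dalembert:
  assumes "0 \<le> t" "t \<le> s"
  shows "L2_rinner M (w1 s) (w t) = (a (s + t) - a (s - t)) / 2"
  using rinner_sum[of s t] rinner_diff[of t s] assms by simp

text \<open>This is \<open>\<integral>\<^sub>0\<^sup>t a\<close>, by d'Alembert's formula on the diagonal.\<close>

definition A :: "real \<Rightarrow> real" where "A t = 2 * (L2_norm M (w (t / 2)))\<^sup>2"

text \<open>The chain rule gives 2 <w'(t/2), w(t/2)>, and this is a(t) by \<open>rinner_sum\<close>
  with both times equal to t/2.\<close>

lemma A_deriv:
  assumes "t \<ge> 0"
  shows "(A has_real_derivative a t) (at t within {0..})"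
proof -
  let ?w = "\<lambda>s. w (0 + 1 / 2 * s)"
  have "L2_deriv_at M ?w (\<lambda>x. (1 / 2) *\<^sub>R w1 (0 + 1 / 2 * t) x) t {0..}"
    using assms by (intro deriv_affine) auto
  from L2_deriv_at_rinner[OF this this]
  have "((\<lambda>s. L2_rinner M (?w s) (?w s)) has_real_derivative L2_rinner M (w1 (t / 2)) (w (t / 2))) (at t within {0..})"
    by (simp add: L2_rinner_scaleR_left L2_rinner_scaleR_right L2_rinner_commute[of M "w (t / 2)"])
  moreover have "A = (\<lambda>s. 2 * L2_rinner M (?w s) (?w s))"
    by (simp add: fun_eq_iff A_def L2_norm_power2)
  ultimately show ?thesis
    using DERIV_cmult[of "\<lambda>s. L2_rinner M (?w s) (?w s)" "L2_rinner M (w1 (t / 2)) (w (t / 2))" t "{0..}" 2]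
      rinner_sum[of "t / 2" "t / 2"] assms
    by simp
qed

lemma A_0: "A 0 = 0"
  by (simp add: A_def L2_norm_power2 w_0 L2)

lemma A_deriv_affine:
  fixes e :: real
  assumes "e \<noteq> 0" "\<And>s. s \<in> S \<Longrightarrow> 0 \<le> c + e * s" "t \<in> S"
  shows "((\<lambda>s. A (c + e * s)) has_real_derivative e * a (c + e * t)) (at t within S)"
proof -
  have "((\<lambda>s. c + e * s) has_real_derivative e) (at t within S)"
    by (auto intro!: derivative_eq_intros)
  moreover have "(A has_real_derivative a (c + e * t)) (at (c + e * t) within (\<lambda>s. c + e * s) ` S)"
    using assms by (intro DERIV_subset[OF A_deriv]) auto
  ultimately show ?thesis using DERIV_image_chain by (fastforce simp: o_def mult.commute)
qed

lemma continuous_a: "continuous_on {0..} a"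
  unfolding continuous_on_def
proof
  fix t :: real assume t: "t \<in> {0..}"
  have "L2_deriv_at M (\<lambda>s. w (0 + 1 * s)) (\<lambda>x. 1 *\<^sub>R w1 (0 + 1 * t) x) t {0..}"
    using t by (intro deriv_affine) auto
  from L2_deriv_at_imp_continuous[OF this]
  have *: "((\<lambda>s. L2_norm M (\<lambda>x. w s x - w t x)) \<longlongrightarrow> 0) (at t within {0..})" by simp
  show "(a \<longlongrightarrow> a t) (at t within {0..})"
    unfolding a_def using t g_L2 L2
    by (intro tendsto_L2_rinner *) (auto simp: L2_norm_def eventually_at_filter)
qed

text \<open>\<open>k (s, t)\<close> is the value of the form at \<open>w s\<close> and \<open>w t\<close>.\<close>

definition k :: "real \<times> real \<Rightarrow> real" where "k p = - L2_rinner M (w2 (fst p)) (w (snd p))"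

text \<open>Joint continuity is what the uniform estimate for double Riemann sums requires. The
  second time derivative is continuous by the notion of solution, and w because it is
  differentiable.\<close>

lemma continuous_k: "continuous_on ({0..} \<times> {0..}) k"
  unfolding continuous_on_def
proof
  fix p :: "real \<times> real" assume p: "p \<in> {0..} \<times> {0..}"
  let ?F = "at p within {0..} \<times> {0..}"
  have ev: "\<forall>\<^sub>F q in ?F. fst q \<ge> 0 \<and> snd q \<ge> 0"
    unfolding eventually_at_filter by (rule always_eventually) auto
  have lim: "((\<lambda>q. L2_norm M (\<lambda>x. v (\<pi> q) x - v (\<pi> p) x)) \<longlongrightarrow> 0) ?F"
    if v: "((\<lambda>s. L2_norm M (\<lambda>x. v s x - v (\<pi> p) x)) \<longlongrightarrow> 0) (at (\<pi> p) within {0..})"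
      and \<pi>: "(\<pi> \<longlongrightarrow> \<pi> p) ?F" "\<forall>\<^sub>F q in ?F. \<pi> q \<ge> 0"
    for v :: "real \<Rightarrow> 'a \<Rightarrow> complex" and \<pi> :: "real \<times> real \<Rightarrow> real"
  proof -
    let ?d = "\<lambda>s. L2_norm M (\<lambda>x. v s x - v (\<pi> p) x)"
    \<comment> \<open>The distance vanishes at \<open>\<pi> p\<close> itself, so the punctured limit
      is continuity there and may be composed with a projection that can take the value
      \<open>\<pi> p\<close>.\<close>
    have "continuous (at (\<pi> p) within {0..}) ?d"
      unfolding continuous_within using v by (simp add: L2_norm_def)
    from continuous_within_tendsto_compose[OF this _ \<pi>(1)] \<pi>(2)
    show ?thesis by (simp add: L2_norm_def)
  qed
  have w2c: "((\<lambda>s. L2_norm M (\<lambda>x. w2 s x - w2 (fst p) x)) \<longlongrightarrow> 0) (at (fst p) within {0..})"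
    using cont p by (auto simp: L2_continuous_def)
  have "L2_deriv_at M (\<lambda>s. w (0 + 1 * s)) (\<lambda>x. 1 *\<^sub>R w1 (0 + 1 * snd p) x) (snd p) {0..}"
    using p by (intro deriv_affine) auto
  from L2_deriv_at_imp_continuous[OF this]
  have wc: "((\<lambda>s. L2_norm M (\<lambda>x. w s x - w (snd p) x)) \<longlongrightarrow> 0) (at (snd p) within {0..})" by simp
  have "((\<lambda>q. L2_rinner M (w2 (fst q)) (w (snd q))) \<longlongrightarrow> L2_rinner M (w2 (fst p)) (w (snd p))) ?F"
  proof (rule tendsto_L2_rinner)
    show "((\<lambda>q. L2_norm M (\<lambda>x. w2 (fst q) x - w2 (fst p) x)) \<longlongrightarrow> 0) ?F"
      by (rule lim[OF w2c tendsto_fst[OF tendsto_ident_at] eventually_mono[OF ev]]) simp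
    show "((\<lambda>q. L2_norm M (\<lambda>x. w (snd q) x - w (snd p) x)) \<longlongrightarrow> 0) ?F"
      by (rule lim[OF wc tendsto_snd[OF tendsto_ident_at] eventually_mono[OF ev]]) simp
    show "\<forall>\<^sub>F q in ?F. w2 (fst q) \<in> L2 M \<and> w (snd q) \<in> L2 M"
      using ev by (rule eventually_mono) (simp add: L2)
  qed (use p L2 in auto)
  then show "(k \<longlongrightarrow> k p) ?F" unfolding k_def by (rule tendsto_minus)
qed

text \<open>Supplies the antiderivative in the first variable that evaluates the inner Riemann
  sums.\<close>

lemma k_deriv:
  assumes "0 \<le> s" "0 \<le> t"
  shows "((\<lambda>s. - L2_rinner M (w1 s) (w t)) has_real_derivative k (s, t)) (at s within {0..})"
proof -
  have "L2_deriv_at M (\<lambda>s. w1 (0 + 1 * s)) (\<lambda>x. 1 *\<^sub>R w2 (0 + 1 * s) x) s {0..}"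
    using assms by (intro deriv_affine) auto
  from L2_deriv_at_rinner[OF this L2_deriv_at_const[OF _ L2(1)[OF assms(2)]]] assms
  have "((\<lambda>s. L2_rinner M (w1 s) (w t)) has_real_derivative L2_rinner M (w2 s) (w t)) (at s within {0..})"
    by (simp add: L2_rinner_def)
  from DERIV_minus[OF this] show ?thesis by (simp add: k_def)
qed

text \<open>\<open>S_op_sum_bound\<close> at the values of w at the nodes; the two sides are the
  discrete <g, X(T)>^2 and C q(X(T), X(T)).\<close>

lemma sum_bound:
  assumes C: "\<And>u. u \<in> D \<Longrightarrow> (L2_rinner M g u)\<^sup>2 \<le> C * form u u" and T: "T \<ge> 0"
  shows "(riemann_sum T n a)\<^sup>2 \<le> C * riemann_sum T n (\<lambda>t. riemann_sum T n (\<lambda>s. k (s, t)))"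
proof -
  define c where "c = T / real n"
  have "c \<ge> 0" using T by (simp add: c_def)
  let ?t = "\<lambda>i. real i * c"
  have "(\<Sum>i<n. c * a (?t i))\<^sup>2 = c\<^sup>2 * (\<Sum>i<n. L2_rinner M g (w (?t i)))\<^sup>2"
    by (simp add: a_def sum_distrib_left[symmetric] power_mult_distrib)
  also have "\<dots> \<le> c\<^sup>2 * (C * (\<Sum>j<n. \<Sum>i<n. L2_rinner M (w (?t j)) (\<lambda>x. - w2 (?t i) x)))"
    using \<open>c \<ge> 0\<close> by (intro mult_left_mono S_op_sum_bound eqn g_L2 C) auto
  \<comment> \<open>The square of the mesh width is shared out, one factor to each sum.\<close>
  also have "\<dots> = C * (\<Sum>j<n. c * (\<Sum>i<n. c * k (?t i, ?t j)))"
    by (simp add: k_def L2_rinner_uminus_left L2_rinner_commute[of M "w _"] sum_distrib_left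
        power2_eq_square mult_ac)
  finally show ?thesis by (simp only: riemann_sum_def c_def)
qed

text \<open>The limit of \<open>sum_bound\<close>: the double integral of \<open>k\<close> over the square of side \<open>T\<close> equals
  \<open>2 A(T) - A(2 T) / 2\<close>.\<close>

lemma key_inequality:
  assumes C: "\<And>u. u \<in> D \<Longrightarrow> (L2_rinner M g u)\<^sup>2 \<le> C * form u u" and T: "T > 0"
  shows "(A T)\<^sup>2 \<le> C * (2 * A T - A (2 * T) / 2)"
proof (rule LIMSEQ_le)
  have "(\<lambda>n. riemann_sum T n a) \<longlonglongrightarrow> A T - A 0"
    using T by (intro riemann_sum_tendsto) (auto intro: DERIV_subset[OF A_deriv] continuous_on_subset[OF continuous_a])
  then show "(\<lambda>n. (riemann_sum T n a)\<^sup>2) \<longlonglongrightarrow> (A T)\<^sup>2" by (intro tendsto_power) (simp add: A_0)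
  \<comment> \<open>The integral of k(s, t) over s in [0, T]: the boundary term at s = 0 is a(t),
    and d'Alembert's formula evaluates the one at s = T.\<close>
  let ?b = "\<lambda>t. a t - (a (T + t) - a (T - t)) / 2"
  \<comment> \<open>An antiderivative of \<open>?b\<close>; the inner derivative -1 of T - t turns
    the difference of values of a into a sum of values of A.\<close>
  let ?B = "\<lambda>t. A (0 + 1 * t) - (A (T + 1 * t) + A (T + (-1) * t)) / 2"
  have "(\<lambda>n. riemann_sum T n ?b) \<longlonglongrightarrow> ?B T - ?B 0"
  proof (rule riemann_sum_tendsto[OF T])
    show "(?B has_real_derivative ?b t) (at t within {0..T})" if "t \<in> {0..T}" for t
    proof -
      have "(?B has_real_derivative 1 * a (0 + 1 * t) - (1 * a (T + 1 * t) + (-1) * a (T + (-1) * t)) / 2) (at t within {0..T})"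
        by (intro DERIV_diff DERIV_cdivide DERIV_add A_deriv_affine) (use that in auto)
      then show ?thesis by simp
    qed
    show "continuous_on {0..T} ?b"
      using T by (intro continuous_intros continuous_on_compose2[OF continuous_a]) auto
  qed
  \<comment> \<open>As A(2 T) = 2 ||w(T)||^2 and A(T) plays the role of <g, X(T)>, this is 2 <g,
    X(T)> - ||w(T)||^2, the value that the energy identity assigns to q(X(T), X(T)).\<close>
  also have "?B T - ?B 0 = 2 * A T - A (2 * T) / 2" by (simp add: A_0)
  finally have 1: "(\<lambda>n. riemann_sum T n ?b) \<longlonglongrightarrow> 2 * A T - A (2 * T) / 2" .
  define G where "G = (\<lambda>t s. - L2_rinner M (w1 s) (w t))"
  have 2: "(\<lambda>n. riemann_sum T n (\<lambda>t. riemann_sum T n (\<lambda>s. k (s, t))) - riemann_sum T n (\<lambda>t. G t T - G t 0)) \<longlonglongrightarrow> 0"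
    unfolding G_def
    by (rule riemann_sum_iterated_diff_tendsto[OF T])
      (auto intro!: DERIV_subset[OF k_deriv] intro: continuous_on_subset[OF continuous_k])
  have 3: "riemann_sum T n (\<lambda>t. G t T - G t 0) = riemann_sum T n ?b" for n
    unfolding riemann_sum_def
  proof (intro sum.cong refl arg_cong[of _ _ "(*) (T / real n)"])
    fix i assume "i \<in> {..<n}"
    then have "0 \<le> real i * (T / real n)" "real i * (T / real n) \<le> T" using T by (auto simp: field_simps)
    then show "G (real i * (T / real n)) T - G (real i * (T / real n)) 0 = ?b (real i * (T / real n))"
      by (simp only: G_def dalembert w1_0 L2 a_def[symmetric])
  qed
  show "(\<lambda>n. C * riemann_sum T n (\<lambda>t. riemann_sum T n (\<lambda>s. k (s, t)))) \<longlonglongrightarrow> C * (2 * A T - A (2 * T) / 2)"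
    using tendsto_add[OF 2 1] unfolding 3 by (intro tendsto_mult_left) simp
  show "\<exists>N. \<forall>n\<ge>N. (riemann_sum T n a)\<^sup>2 \<le> C * riemann_sum T n (\<lambda>t. riemann_sum T n (\<lambda>s. k (s, t)))"
    using sum_bound[OF C] T by auto
qed

text \<open>Completing the square: (A(t) - C)^2 >= 0 bounds 2 C A(t) - A(t)^2 by C^2, so
  \<open>key_inequality\<close> gives A(2 t) <= 2 C, and A(2 t) is 2 ||w(t)||^2. Time 0 is separate
  because the Riemann sums need an interval of positive length.\<close>

lemma norm_bound:
  assumes C: "\<And>u. u \<in> D \<Longrightarrow> (L2_rinner M g u)\<^sup>2 \<le> C * form u u" and C0: "C > 0" and t: "t \<ge> 0"
  shows "L2_norm M (w t) \<le> sqrt C"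
proof (cases "t = 0")
  case True
  then show ?thesis using C0 by (simp add: L2_norm_rinner w_0 L2)
next
  case False
  have "A (2 * t) * C \<le> 2 * C * C"
    using key_inequality[OF C, of t] False t zero_le_power2[of "A t - C"]
    by (simp add: power2_eq_square algebra_simps)
  then have "A (2 * t) \<le> 2 * C" using C0 by (simp add: mult.commute)
  then have "(L2_norm M (w t))\<^sup>2 \<le> C" by (simp add: A_def)
  then show ?thesis by (rule real_le_rsqrt)
qed

end

theorem corollary1p4:
  fixes \<Omega> :: "'a::euclidean_space set" and V :: "'a \<Rightarrow> real"
  assumes "open \<Omega>" and "connected \<Omega>" and "\<Omega> \<noteq> {}"
    and "continuous_on \<Omega> V"
    and "\<forall>u\<in>test_functions \<Omega>. 0 \<le> energy_form \<Omega> V u"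
    and "subcritical \<Omega> V"
  shows "\<forall>g\<in>test_functions \<Omega>. \<forall>w. wave_solution (lebesgue_on \<Omega>) (S_op \<Omega> V) g w \<longrightarrow>
           bdd_above ((\<lambda>t. L2_norm (lebesgue_on \<Omega>) (w t)) ` {0..})"
proof (intro ballI allI impI)
  fix g w assume g: "g \<in> test_functions \<Omega>" and "wave_solution (lebesgue_on \<Omega>) (S_op \<Omega> V) g w"
  then obtain w1 w2 where w:
    "\<forall>t\<ge>0. w t \<in> L2 (lebesgue_on \<Omega>) \<and> w1 t \<in> L2 (lebesgue_on \<Omega>) \<and> w2 t \<in> L2 (lebesgue_on \<Omega>)"
    "has_L2_deriv (lebesgue_on \<Omega>) w w1" "has_L2_deriv (lebesgue_on \<Omega>) w1 w2"
    "L2_continuous (lebesgue_on \<Omega>) w2" "\<forall>t\<ge>0. (w t, \<lambda>x. - w2 t x) \<in> S_op \<Omega> V"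
    "AE x in lebesgue_on \<Omega>. w 0 x = 0" "AE x in lebesgue_on \<Omega>. w1 0 x = g x"
    unfolding wave_solution_def by blast
  interpret wave \<Omega> V g w w1 w2
    using assms g w by unfold_locales auto
  obtain C where "C > 0" "\<And>u. u \<in> test_functions \<Omega> \<Longrightarrow> (L2_rinner (lebesgue_on \<Omega>) g u)\<^sup>2 \<le> C * form u u"
    using subcritical_form_bound[OF assms(6) g] by blast
  \<comment> \<open>C was obtained from g alone, hence the bound is uniform in time.\<close>
  with norm_bound show "bdd_above ((\<lambda>t. L2_norm (lebesgue_on \<Omega>) (w t)) ` {0..})"
    by (intro bdd_aboveI2[of _ _ "sqrt C"]) auto
qed

end
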